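(* Let $n\ge3$, $\alpha\in(0,n)$, $p,q>0$ with $pq>1$ and $p\le q$, and assume $\frac{1}{p+1}+\frac{1}{q+1}\le\frac{n-\alpha}{n}$. Let $(u,v)\in L^{r_0}(\mathbb{R}^n)\times L^{s_0}(\mathbb{R}^n)$, where $r_0=\frac{n(pq-1)}{\alpha(q+1)}$, $s_0=\frac{n(pq-1)}{\alpha(p+1)}$, be a pair of positive solutions of $$u(x)=\int_{\mathbb{R}^n}\frac{v^q(y)\,dy}{|x-y|^{n-\alpha}},\qquad v(x)=\int_{\mathbb{R}^n}\frac{u^p(y)\,dy}{|x-y|^{n-\alpha}}.$$ Then $(u,v)\in L^r(\mathbb{R}^n)\times L^s(\mathbb{R}^n)$ for all $r,s$ with $$\frac1r\in\Big(0,\frac{n-\alpha}{n}\Big),\qquad \frac1s\in\Big(0,\min\Big\{\frac{n-\alpha}{n},\frac{pn-(p+1)\alpha}{n}\Big\}\Big).$$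
   Context: Positive solutions are positive measurable functions satisfying both integral identities (finite) at every point. *)

theory Defs
  imports "HOL-Analysis.Analysis"
begin

definition in_Lp :: "real \<Rightarrow> ('a::euclidean_space \<Rightarrow> real) \<Rightarrow> bool" where
  "in_Lp r f \<longleftrightarrow> f \<in> borel_measurable lebesgue \<and> integrable lebesgue (\<lambda>x. \<bar>f x\<bar> powr r)"

definition riesz_pot :: "real \<Rightarrow> ('a::euclidean_space \<Rightarrow> real) \<Rightarrow> 'a \<Rightarrow> ennreal" where
  "riesz_pot \<alpha> g x = (\<integral>\<^sup>+ y. ennreal (g y / norm (x - y) powr (real DIM('a) - \<alpha>)) \<partial>lebesgue)"

text \<open>Positive solution pair: positive measurable functions satisfying both identities at every
  point, with finite values (automatic since u x, v x are real).\<close>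
definition positive_solution :: "real \<Rightarrow> real \<Rightarrow> real \<Rightarrow> ('a::euclidean_space \<Rightarrow> real) \<Rightarrow> ('a \<Rightarrow> real) \<Rightarrow> bool" where
  "positive_solution \<alpha> p q u v \<longleftrightarrow>
     u \<in> borel_measurable lebesgue \<and> v \<in> borel_measurable lebesgue \<and>
     (\<forall>x. u x > 0 \<and> v x > 0) \<and>
     (\<forall>x. ennreal (u x) = riesz_pot \<alpha> (\<lambda>y. v y powr q) x) \<and>
     (\<forall>x. ennreal (v x) = riesz_pot \<alpha> (\<lambda>y. u y powr p) x)"

end

theory Submission
  imports Defs
begin

text \<open>
  Regularity lifting. Split \<open>v = v\<^sub>A + v\<^sub>B\<close>, where \<open>v\<^sub>B\<close> is the bounded, compactly supported
  part of \<open>v\<close> and the \<open>L\<^bsup>s\<^sub>0\<^esup>\<close> norm of \<open>v\<^sub>A\<close> is small. With \<open>I\<close> the Riesz potential, the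
  system becomes the single equation \<open>u = I(v\<^sub>B^q) + T u\<close> with
  \<open>T f = I(v\<^sub>A^(q - 1/p) (I(f^p))^(1/p))\<close>. The operator \<open>T\<close> is monotone and homogeneous of
  degree one even if \<open>p < 1\<close>. By the Hardy-Littlewood-Sobolev and Hoelder inequalities its norm on
  \<open>L\<^sup>r\<close> is at most a constant times a positive power of the norm of \<open>v\<^sub>A\<close>, whenever
  \<open>\<alpha>/(pn) < 1/r < min (1/p) (1 - \<alpha>/n)\<close>, and \<open>r = r\<^sub>0\<close> is in this range. Iterating the equation
  bounds \<open>u\<close> by a part bounded in \<open>L\<^sup>r\<close> plus a part tending to zero in \<open>L\<^bsup>r\<^sub>0\<^esup>\<close>. The full ranges
  follow by applying the Hardy-Littlewood-Sobolev inequality once to \<open>v = I(u^p)\<close> and then once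
  to \<open>u = I(v^q)\<close>.
\<close>

section \<open>Powers of extended nonnegative reals\<close>

text \<open>Infinity is sent to infinity for every exponent, and 0 to 0 because
  \<open>0 powr a = 0\<close>, also for \<open>a \<le> 0\<close>. With these conventions the laws
  for products, sums of exponents and iterated powers hold without side conditions.\<close>

definition epow :: "ennreal \<Rightarrow> real \<Rightarrow> ennreal" where
  "epow x a = (if x = \<infinity> then \<infinity> else ennreal (enn2real x powr a))"

lemma epow_ennreal [simp]: "0 \<le> r \<Longrightarrow> epow (ennreal r) a = ennreal (r powr a)"
  by (simp add: epow_def)

lemma epow_top [simp]: "epow \<infinity> a = \<infinity>" "epow top a = top"
  by (simp_all add: epow_def)

lemma epow_zero [simp]: "epow 0 a = 0"
  by (simp add: epow_def)

lemma epow_one_right [simp]: "epow x 1 = x"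
  by (cases x) (auto simp: epow_def)

lemma epow_eq_top_iff [simp]: "epow x a = top \<longleftrightarrow> x = top"
  by (simp add: epow_def)

lemma epow_less_top_iff [simp]: "epow x a < top \<longleftrightarrow> x < top"
  by (simp add: less_top[symmetric])

lemma epow_eq_zero_iff [simp]: "epow x a = 0 \<longleftrightarrow> x = 0"
  by (cases x) (auto simp: epow_def)

lemma epow_mono: "x \<le> y \<Longrightarrow> 0 \<le> a \<Longrightarrow> epow x a \<le> epow y a"
  by (cases x; cases y) (auto simp: powr_mono2 ennreal_leI top_unique)

lemma epow_mult: "epow (x * y) a = epow x a * epow y a"
proof (cases "x = top \<or> y = top")
  case True
  then show ?thesis
    by (cases "x = 0 \<or> y = 0") (auto simp: ennreal_top_mult ennreal_mult_top)
next
  case False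
  then obtain r s where "0 \<le> r" "0 \<le> s" "x = ennreal r" "y = ennreal s"
    by (metis ennreal_cases)
  then show ?thesis
    by (simp add: ennreal_mult[symmetric] powr_mult)
qed

lemma epow_epow: "epow (epow x a) b = epow x (a * b)"
  by (cases x) (auto simp: powr_powr)

lemma epow_add_right: "epow x (a + b) = epow x a * epow x b"
  by (cases x) (auto simp: powr_add ennreal_mult)

text \<open>Powers with exponents \<open>a\<close> and \<open>1 / a\<close> are mutually inverse
  monotone maps. This adjunction makes powers commute with suprema in
  \<open>epow_SUP\<close>.\<close>

lemma epow_le_iff:
  assumes "0 < a"
  shows "epow x a \<le> y \<longleftrightarrow> x \<le> epow y (1 / a)"
proof
  assume "epow x a \<le> y"
  then have "epow (epow x a) (1 / a) \<le> epow y (1 / a)"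
    using assms by (intro epow_mono) auto
  then show "x \<le> epow y (1 / a)"
    using assms by (simp add: epow_epow)
next
  assume "x \<le> epow y (1 / a)"
  then have "epow x a \<le> epow (epow y (1 / a)) a"
    using assms by (intro epow_mono) auto
  then show "epow x a \<le> y"
    using assms by (simp add: epow_epow)
qed

lemma epow_SUP:
  assumes "0 < a"
  shows "epow (SUP i\<in>I. f i) a = (SUP i\<in>I. epow (f i) a)"
proof (rule antisym)
  show "epow (SUP i\<in>I. f i) a \<le> (SUP i\<in>I. epow (f i) a)"
    unfolding epow_le_iff[OF assms]
    by (intro SUP_least) (auto simp: epow_le_iff[OF assms, symmetric] intro: SUP_upper)
  show "(SUP i\<in>I. epow (f i) a) \<le> epow (SUP i\<in>I. f i) a"
    using assms by (intro SUP_least epow_mono) (auto intro: SUP_upper)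
qed

text \<open>A sum is at most twice the maximum, which treats exponents below and above 1 alike.
  Serves as a quasi-triangle inequality, also when \<open>p < 1\<close>.\<close>

lemma epow_add_le:
  assumes "0 < a"
  shows "epow (x + y) a \<le> ennreal (2 powr a) * (epow x a + epow y a)"
proof -
  have "x + y \<le> 2 * max x y"
    by (metis add_mono max.cobounded1 max.cobounded2 mult_2)
  then have "epow (x + y) a \<le> epow (ennreal 2 * max x y) a"
    using assms by (intro epow_mono) auto
  also have "\<dots> = ennreal (2 powr a) * epow (max x y) a"
    unfolding epow_mult by (subst epow_ennreal) auto
  also have "epow (max x y) a \<le> epow x a + epow y a"
    by (auto simp: max_def)
  finally show ?thesis
    by (simp add: mult_left_mono)
qed

lemma measurable_epow [measurable (raw)]:
  assumes [measurable]: "f \<in> borel_measurable M"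
  shows "(\<lambda>x. epow (f x) a) \<in> borel_measurable M"
  unfolding epow_def by measurable

section \<open>Young and Hoelder inequalities in the extended nonnegative reals\<close>

lemma ennreal_Youngs_inequality:
  fixes x y :: ennreal
  assumes "1 < p" "1 < q" "1 / p + 1 / q = 1"
  shows "x * y \<le> ennreal (1 / p) * epow x p + ennreal (1 / q) * epow y q"
proof (cases "x = top \<or> y = top")
  case True
  then show ?thesis
    using assms by (auto simp: ennreal_mult_top ennreal_top_mult)
next
  case False
  then obtain r s where rs: "0 \<le> r" "0 \<le> s" "x = ennreal r" "y = ennreal s"
    by (metis ennreal_cases)
  have "r * s \<le> r powr p / p + s powr q / q"
    using assms rs by (intro Youngs_inequality) auto
  then show ?thesis
    using rs assms
    by (auto simp: ennreal_mult[symmetric] ennreal_plus[symmetric] simp del: ennreal_plus intro!: ennreal_leI)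
qed

lemma nn_integral_Holder:
  assumes [measurable]: "f \<in> borel_measurable M" "g \<in> borel_measurable M"
    and pq: "1 < p" "1 < q" "1 / p + 1 / q = 1"
  shows "(\<integral>\<^sup>+x. f x * g x \<partial>M)
           \<le> epow (\<integral>\<^sup>+x. epow (f x) p \<partial>M) (1 / p) * epow (\<integral>\<^sup>+x. epow (g x) q \<partial>M) (1 / q)"
    (is "?L \<le> epow ?F _ * epow ?G _")
proof (cases "?F = 0 \<or> ?G = 0")
  case True
  then have "AE x in M. f x * g x = 0"
    by (auto simp: nn_integral_0_iff_AE)
  then have "?L = (\<integral>\<^sup>+x. 0 \<partial>M)"
    by (rule nn_integral_cong_AE)
  then show ?thesis by simp
next
  case False
  show ?thesis
  proof (cases "?F = top \<or> ?G = top")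
    case True
    with False show ?thesis
      by (auto simp: ennreal_mult_top ennreal_top_mult)
  next
    case nt: False
    with False obtain a b where ab: "0 < a" "0 < b" "?F = ennreal a" "?G = ennreal b"
      by (metis ennreal_cases ennreal_0 less_eq_real_def top_neq_ennreal)
    \<comment> \<open>\<open>A\<close> and \<open>B\<close> are the two norms. For the functions
      divided by them the Young bound integrates to \<open>1 / p + 1 / q = 1\<close>, and
      multiplying by \<open>A * B\<close> gives the claim.\<close>
    define A where "A = a powr (1 / p)"
    define B where "B = b powr (1 / q)"
    have AB: "0 < A" "0 < B" using ab by (auto simp: A_def B_def)
    have "ennreal (1 / A) * ennreal (1 / B) * ?L
          = (\<integral>\<^sup>+x. (ennreal (1 / A) * f x) * (ennreal (1 / B) * g x) \<partial>M)"
      by (subst nn_integral_cmult[symmetric]) (auto simp: ac_simps)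
    also have "\<dots> \<le> (\<integral>\<^sup>+x. ennreal (1 / p) * epow (ennreal (1 / A) * f x) p
                          + ennreal (1 / q) * epow (ennreal (1 / B) * g x) q \<partial>M)"
      by (intro nn_integral_mono ennreal_Youngs_inequality pq)
    also have "\<dots> = ennreal (1 / p) * (ennreal ((1 / A) powr p) * ?F) + ennreal (1 / q) * (ennreal ((1 / B) powr q) * ?G)"
      using AB by (simp add: epow_mult nn_integral_add nn_integral_cmult)
    also have "ennreal ((1 / A) powr p) * ?F = 1"
      using ab pq by (simp add: A_def powr_divide powr_powr ennreal_mult[symmetric])
    also have "ennreal ((1 / B) powr q) * ?G = 1"
      using ab pq by (simp add: B_def powr_divide powr_powr ennreal_mult[symmetric])
    also have "ennreal (1 / p) * 1 + ennreal (1 / q) * 1 = 1"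
      using pq by (simp add: ennreal_plus[symmetric] del: ennreal_plus)
    finally have "ennreal (1 / A) * ennreal (1 / B) * ?L \<le> 1" .
    then have "ennreal (A * B) * (ennreal (1 / A) * ennreal (1 / B) * ?L) \<le> ennreal (A * B) * 1"
      by (intro mult_left_mono) auto
    moreover have "ennreal (A * B) * (ennreal (1 / A) * ennreal (1 / B) * ?L) = ?L"
      using AB by (simp add: ennreal_mult[symmetric] mult.assoc[symmetric])
    ultimately show ?thesis
      using ab AB by (simp add: A_def B_def ennreal_mult)
  qed
qed

section \<open>Integrals of powers and the layer cake formula\<close>

lemma nn_integral_powr_from_0:
  assumes "0 < c" "0 \<le> X"
  shows "(\<integral>\<^sup>+t. ennreal (t powr (c - 1)) * indicator {0<..<X} t \<partial>lborel) = ennreal (X powr c / c)"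
proof -
  have "((\<lambda>t. t powr (c - 1)) has_integral (X powr c / c)) {0..X}"
    using has_integral_powr_from_0[of "c - 1" X] assms by simp
  then have "(\<integral>\<^sup>+t. ennreal (t powr (c - 1)) * indicator {0..X} t \<partial>lborel) = ennreal (X powr c / c)"
    by (intro nn_integral_has_integral_lebesgue') auto
  moreover have "(\<integral>\<^sup>+t. ennreal (t powr (c - 1)) * indicator {0<..<X} t \<partial>lborel)
      = (\<integral>\<^sup>+t. ennreal (t powr (c - 1)) * indicator {0..X} t \<partial>lborel)"
    by (intro nn_integral_cong_AE, use AE_lborel_singleton[of 0] AE_lborel_singleton[of X] in eventually_elim)
       (auto split: split_indicator)
  ultimately show ?thesis by simp
qed

lemma nn_integral_powr_to_inf:
  assumes "c < 0" "0 < R"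
  shows "(\<integral>\<^sup>+t. ennreal (t powr (c - 1)) * indicator {R..} t \<partial>lborel) = ennreal (R powr c / - c)"
proof -
  have "((\<lambda>t. t powr (c - 1)) has_integral (R powr c / - c)) {R..}"
    using has_integral_powr_to_inf[of "c - 1" R] assms by simp
  then show ?thesis
    by (intro nn_integral_has_integral_lebesgue') auto
qed

lemma epow_layer_cake:
  assumes "0 < b"
  shows "epow h b = (\<integral>\<^sup>+t. ennreal (b * t powr (b - 1)) * indicator {t. 0 < t \<and> ennreal t < h} t \<partial>lborel)"
    (is "_ = ?I h")
proof -
  have fin: "?I (ennreal X) = epow (ennreal X) b" if "0 \<le> X" for X
  proof -
    have "?I (ennreal X) = (\<integral>\<^sup>+t. ennreal b * (ennreal (t powr (b - 1)) * indicator {0<..<X} t) \<partial>lborel)"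
      using assms by (intro nn_integral_cong) (auto split: split_indicator simp: ennreal_mult ennreal_less_iff)
    also have "\<dots> = ennreal b * ennreal (X powr b / b)"
      using assms that by (subst nn_integral_cmult) (auto simp: nn_integral_powr_from_0)
    finally show ?thesis
      using assms that by (simp add: ennreal_mult[symmetric])
  qed
  show ?thesis
  proof (cases h)
    case (real X)
    then show ?thesis using fin[of X] by simp
  next
    case top
    \<comment> \<open>Height \<open>real k powr (1 / b)\<close> already gives the value
      \<open>k\<close>, so the integral for infinite height is at least every natural
      number.\<close>
    have "ennreal (real k) \<le> ?I top" for k
    proof -
      have "ennreal (real k) = ?I (ennreal (real k powr (1 / b)))"
        using fin[of "real k powr (1 / b)"] assms by (simp add: powr_powr)
      also have "\<dots> \<le> ?I top"
        by (intro nn_integral_mono) (auto split: split_indicator)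
      finally show ?thesis .
    qed
    then have "?I top = top"
      by (metis ennreal_of_nat_eq_real_of_nat ennreal_Ex_less_of_nat linorder_not_le top.not_eq_extremum)
    with top show ?thesis by simp
  qed
qed

section \<open>Riesz potentials\<close>

text \<open>Densities are extended-valued and integrated against \<open>lborel\<close>, so no
  finiteness is presupposed and Fubini applies directly. On the diagonal the kernel takes the value
  0 since \<open>0 powr a = 0\<close>, which affects a null set only.\<close>

definition riesz :: "real \<Rightarrow> ('a::euclidean_space \<Rightarrow> ennreal) \<Rightarrow> 'a \<Rightarrow> ennreal" where
  "riesz \<alpha> g x = (\<integral>\<^sup>+y. g y * ennreal (norm (x - y) powr (\<alpha> - real DIM('a))) \<partial>lborel)"

lemma measurable_riesz [measurable]:
  fixes g :: "'a::euclidean_space \<Rightarrow> ennreal"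
  assumes [measurable]: "g \<in> borel_measurable borel"
  shows "riesz \<alpha> g \<in> borel_measurable borel"
proof -
  have "(\<lambda>x. \<integral>\<^sup>+y. g y * ennreal (norm (x - y) powr (\<alpha> - real DIM('a))) \<partial>lborel) \<in> borel_measurable lborel"
    by measurable
  then show ?thesis by (simp add: riesz_def[abs_def])
qed

lemma riesz_mono: "(\<And>y. f y \<le> g y) \<Longrightarrow> riesz \<alpha> f x \<le> riesz \<alpha> g x"
  unfolding riesz_def by (intro nn_integral_mono mult_right_mono) auto

lemma riesz_add:
  assumes [measurable]: "f \<in> borel_measurable borel" "g \<in> borel_measurable borel"
  shows "riesz \<alpha> (\<lambda>y. f y + g y) x = riesz \<alpha> f x + riesz \<alpha> g x"
  unfolding riesz_def by (simp add: nn_integral_add distrib_right)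

lemma riesz_cmult:
  assumes [measurable]: "g \<in> borel_measurable borel"
  shows "riesz \<alpha> (\<lambda>y. c * g y) x = c * riesz \<alpha> g x"
  unfolding riesz_def by (simp add: nn_integral_cmult mult.assoc)

section \<open>Integrals of the kernel over balls and their complements\<close>

lemma kernel_layer_cake:
  fixes z :: "'a::euclidean_space"
  assumes "0 < \<beta>"
  shows "ennreal (norm z powr - \<beta>)
    \<le> (\<integral>\<^sup>+t. ennreal (\<beta> * t powr (- \<beta> - 1)) * indicator {t. 0 < t \<and> norm z \<le> t} t \<partial>lborel)"
proof (cases "z = 0")
  case False
  then have "(\<integral>\<^sup>+t. ennreal (\<beta> * t powr (- \<beta> - 1)) * indicator {t. 0 < t \<and> norm z \<le> t} t \<partial>lborel)
    = (\<integral>\<^sup>+t. ennreal \<beta> * (ennreal (t powr (- \<beta> - 1)) * indicator {norm z..} t) \<partial>lborel)"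
    using assms by (intro nn_integral_cong) (auto split: split_indicator simp: ennreal_mult dest: less_le_trans[of 0 "norm z", rotated])
  also have "\<dots> = ennreal \<beta> * ennreal (norm z powr - \<beta> / \<beta>)"
    using assms False nn_integral_powr_to_inf[of "- \<beta>" "norm z"] by (subst nn_integral_cmult) auto
  also have "\<dots> = ennreal (norm z powr - \<beta>)"
    using assms by (simp add: ennreal_mult[symmetric])
  finally show ?thesis by simp
\<comment> \<open>The case \<open>z = 0\<close>: the left side is 0 by the convention for
  \<open>powr\<close> while the right side is infinite, hence only an inequality is stated.\<close>
qed simp

lemma emeasure_cball_powr:
  fixes x :: "'a::euclidean_space"
  assumes "0 < t"
  shows "emeasure lborel (cball x t) = ennreal (unit_ball_vol (real DIM('a)) * t powr real DIM('a))"
  using assms by (simp add: emeasure_cball powr_realpow)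

text \<open>Fubini turns the layer cake of the kernel into a one-dimensional integral of volumes:
  the points of \<open>S\<close> at distance at most \<open>t\<close> from \<open>x\<close> form
  \<open>cball x t \<inter> S\<close>.\<close>

lemma nn_integral_kernel_layer_cake:
  fixes x :: "'a::euclidean_space"
  assumes "0 < \<beta>" and [measurable]: "S \<in> sets borel"
  shows "(\<integral>\<^sup>+y. ennreal (norm (x - y) powr - \<beta>) * indicator S y \<partial>lborel)
    \<le> (\<integral>\<^sup>+t. ennreal (\<beta> * t powr (- \<beta> - 1)) * indicator {0<..} t * emeasure lborel (cball x t \<inter> S) \<partial>lborel)"
proof -
  have "(\<integral>\<^sup>+y. ennreal (norm (x - y) powr - \<beta>) * indicator S y \<partial>lborel)
     \<le> (\<integral>\<^sup>+y. (\<integral>\<^sup>+t. ennreal (\<beta> * t powr (- \<beta> - 1)) * indicator {t. 0 < t \<and> norm (x - y) \<le> t} t \<partial>lborel) * indicator S y \<partial>lborel)"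
    using assms by (intro nn_integral_mono mult_right_mono kernel_layer_cake) auto
  also have "\<dots> = (\<integral>\<^sup>+y. (\<integral>\<^sup>+t. ennreal (\<beta> * t powr (- \<beta> - 1)) * indicator {t. 0 < t \<and> norm (x - y) \<le> t} t * indicator S y \<partial>lborel) \<partial>lborel)"
    by (intro nn_integral_cong nn_integral_multc[symmetric]) measurable
  also have "\<dots> = (\<integral>\<^sup>+t. (\<integral>\<^sup>+y. ennreal (\<beta> * t powr (- \<beta> - 1)) * indicator {t. 0 < t \<and> norm (x - y) \<le> t} t * indicator S y \<partial>lborel) \<partial>lborel)"
    by (rule lborel_pair.Fubini') measurable
  also have "\<dots> = (\<integral>\<^sup>+t. (\<integral>\<^sup>+y. (ennreal (\<beta> * t powr (- \<beta> - 1)) * indicator {0<..} t) * indicator (cball x t \<inter> S) y \<partial>lborel) \<partial>lborel)"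
    by (intro nn_integral_cong) (auto split: split_indicator simp: dist_norm)
  also have "\<dots> = (\<integral>\<^sup>+t. ennreal (\<beta> * t powr (- \<beta> - 1)) * indicator {0<..} t * emeasure lborel (cball x t \<inter> S) \<partial>lborel)"
    by (intro nn_integral_cong nn_integral_cmult_indicator) auto
  finally show ?thesis .
qed

lemma nn_integral_kernel_ball:
  assumes "0 < \<alpha>" "\<alpha> < real DIM('a::euclidean_space)"
  obtains C where "0 < C" and "\<And>x::'a. \<And>R. 0 < R \<Longrightarrow>
    (\<integral>\<^sup>+y. ennreal (norm (x - y) powr (\<alpha> - real DIM('a))) * indicator (ball x R) y \<partial>lborel) \<le> ennreal (C * R powr \<alpha>)"
proof -
  define n where "n = real DIM('a)"
  define \<beta> where "\<beta> = n - \<alpha>"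
  define \<omega> where "\<omega> = unit_ball_vol n"
  have \<beta>: "0 < \<beta>" and \<omega>: "0 < \<omega>"
    using assms by (auto simp: \<beta>_def \<omega>_def n_def)
  show ?thesis
  proof (rule that[of "\<omega> * (\<beta> / \<alpha> + 1)"])
    show "0 < \<omega> * (\<beta> / \<alpha> + 1)" using \<beta> \<omega> assms by (simp add: add_pos_pos)
  next
    fix x :: 'a and R :: real
    assume R: "0 < R"
    have "(\<integral>\<^sup>+y. ennreal (norm (x - y) powr - \<beta>) * indicator (ball x R) y \<partial>lborel)
      \<le> (\<integral>\<^sup>+t. ennreal (\<beta> * t powr (- \<beta> - 1)) * indicator {0<..} t * emeasure lborel (cball x t \<inter> ball x R) \<partial>lborel)"
      by (rule nn_integral_kernel_layer_cake) (use \<beta> in auto)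
    \<comment> \<open>Split at \<open>t = R\<close>. Below, the volume is of order
      \<open>t powr n\<close>, which leaves the weight \<open>t powr (\<alpha> - 1)\<close>,
      integrable at 0 since \<alpha> is positive. Above, the volume is at most that of the ball of
      radius \<open>R\<close>, and \<open>t powr (- \<beta> - 1)\<close> is integrable at
      infinity.\<close>
    also have "\<dots> \<le> (\<integral>\<^sup>+t. ennreal (\<beta> * \<omega>) * (ennreal (t powr (\<alpha> - 1)) * indicator {0<..<R} t)
         + ennreal (\<beta> * \<omega> * R powr n) * (ennreal (t powr (- \<beta> - 1)) * indicator {R..} t) \<partial>lborel)"
    proof (intro nn_integral_mono)
      fix t :: real
      consider "t \<le> 0" | "0 < t" "t < R" | "R \<le> t" by linarith
      then show "ennreal (\<beta> * t powr (- \<beta> - 1)) * indicator {0<..} t * emeasure lborel (cball x t \<inter> ball x R)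
        \<le> ennreal (\<beta> * \<omega>) * (ennreal (t powr (\<alpha> - 1)) * indicator {0<..<R} t)
         + ennreal (\<beta> * \<omega> * R powr n) * (ennreal (t powr (- \<beta> - 1)) * indicator {R..} t)"
      proof cases
        case 2
        have "emeasure lborel (cball x t \<inter> ball x R) \<le> emeasure lborel (cball x t)"
          by (intro emeasure_mono) auto
        also have "\<dots> = ennreal (\<omega> * t powr n)"
          using 2 by (simp add: emeasure_cball_powr \<omega>_def n_def)
        finally have "ennreal (\<beta> * t powr (- \<beta> - 1)) * emeasure lborel (cball x t \<inter> ball x R)
            \<le> ennreal (\<beta> * t powr (- \<beta> - 1)) * ennreal (\<omega> * t powr n)"
          by (rule mult_left_mono) simp
        also have "\<dots> = ennreal (\<beta> * \<omega> * (t powr (- \<beta> - 1) * t powr n))"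
          using \<beta> \<omega> by (simp add: ennreal_mult[symmetric] ac_simps)
        also have "t powr (- \<beta> - 1) * t powr n = t powr (\<alpha> - 1)"
          by (simp add: powr_add[symmetric] \<beta>_def)
        finally show ?thesis using 2 \<beta> \<omega> by (simp add: ennreal_mult)
      next
        case 3
        have "emeasure lborel (cball x t \<inter> ball x R) \<le> emeasure lborel (cball x R)"
          by (intro emeasure_mono) auto
        also have "\<dots> = ennreal (\<omega> * R powr n)"
          using R by (simp add: emeasure_cball_powr \<omega>_def n_def)
        finally have "ennreal (\<beta> * t powr (- \<beta> - 1)) * emeasure lborel (cball x t \<inter> ball x R)
            \<le> ennreal (\<beta> * t powr (- \<beta> - 1)) * ennreal (\<omega> * R powr n)"
          by (rule mult_left_mono) simp
        also have "\<dots> = ennreal (\<beta> * \<omega> * R powr n) * ennreal (t powr (- \<beta> - 1))"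
          using \<beta> \<omega> by (simp add: ennreal_mult[symmetric] ac_simps)
        finally show ?thesis using 3 R by simp
      qed simp
    qed
    also have "\<dots> = ennreal (\<beta> * \<omega>) * ennreal (R powr \<alpha> / \<alpha>) + ennreal (\<beta> * \<omega> * R powr n) * ennreal (R powr - \<beta> / \<beta>)"
      using \<beta> assms R nn_integral_powr_to_inf[of "- \<beta>" R]
      by (simp add: nn_integral_add nn_integral_cmult nn_integral_powr_from_0)
    also have "\<dots> = ennreal (\<beta> * \<omega> * (R powr \<alpha> / \<alpha>) + \<omega> * (R powr n * R powr - \<beta>))"
      using \<beta> \<omega> assms by (simp add: ennreal_mult[symmetric] ennreal_plus[symmetric] del: ennreal_plus)
    also have "R powr n * R powr - \<beta> = R powr \<alpha>"
      by (simp add: powr_add[symmetric] \<beta>_def)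
    also have "\<beta> * \<omega> * (R powr \<alpha> / \<alpha>) + \<omega> * R powr \<alpha> = \<omega> * (\<beta> / \<alpha> + 1) * R powr \<alpha>"
      by (simp add: distrib_left distrib_right)
    also have "- \<beta> = \<alpha> - real DIM('a)"
      by (simp add: \<beta>_def n_def)
    finally show "(\<integral>\<^sup>+y. ennreal (norm (x - y) powr (\<alpha> - real DIM('a))) * indicator (ball x R) y \<partial>lborel)
      \<le> ennreal (\<omega> * (\<beta> / \<alpha> + 1) * R powr \<alpha>)" .
  qed
qed

text \<open>Levels \<open>t < R\<close> contribute nothing because \<open>cball x t\<close> misses
  the complement. At infinity the volume growth \<open>t powr n\<close> loses against the weight
  \<open>t powr (- \<gamma> - 1)\<close>.\<close>

lemma nn_integral_kernel_outside_ball: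
  assumes "real DIM('a::euclidean_space) < \<gamma>"
  obtains C where "0 < C" and "\<And>x::'a. \<And>R. 0 < R \<Longrightarrow>
    (\<integral>\<^sup>+y. ennreal (norm (x - y) powr - \<gamma>) * indicator (- ball x R) y \<partial>lborel) \<le> ennreal (C * R powr (real DIM('a) - \<gamma>))"
proof -
  define n where "n = real DIM('a)"
  define \<omega> where "\<omega> = unit_ball_vol n"
  have \<omega>: "0 < \<omega>" and n: "n < \<gamma>" "0 < n"
    using assms by (auto simp: \<omega>_def n_def)
  show ?thesis
  proof (rule that[of "\<gamma> * \<omega> / (\<gamma> - n)"])
    show "0 < \<gamma> * \<omega> / (\<gamma> - n)" using \<omega> n by simp
  next
    fix x :: 'a and R :: real
    assume R: "0 < R"
    have "(\<integral>\<^sup>+y. ennreal (norm (x - y) powr - \<gamma>) * indicator (- ball x R) y \<partial>lborel)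
      \<le> (\<integral>\<^sup>+t. ennreal (\<gamma> * t powr (- \<gamma> - 1)) * indicator {0<..} t * emeasure lborel (cball x t \<inter> - ball x R) \<partial>lborel)"
      by (rule nn_integral_kernel_layer_cake) (use n in auto)
    also have "\<dots> \<le> (\<integral>\<^sup>+t. ennreal (\<gamma> * \<omega>) * (ennreal (t powr (n - \<gamma> - 1)) * indicator {R..} t) \<partial>lborel)"
    proof (intro nn_integral_mono)
      fix t :: real
      show "ennreal (\<gamma> * t powr (- \<gamma> - 1)) * indicator {0<..} t * emeasure lborel (cball x t \<inter> - ball x R)
        \<le> ennreal (\<gamma> * \<omega>) * (ennreal (t powr (n - \<gamma> - 1)) * indicator {R..} t)"
      proof (cases "R \<le> t")
        case True
        have "emeasure lborel (cball x t \<inter> - ball x R) \<le> emeasure lborel (cball x t)"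
          by (intro emeasure_mono) auto
        also have "\<dots> = ennreal (\<omega> * t powr n)"
          using True R by (simp add: emeasure_cball_powr \<omega>_def n_def)
        finally have "ennreal (\<gamma> * t powr (- \<gamma> - 1)) * emeasure lborel (cball x t \<inter> - ball x R)
            \<le> ennreal (\<gamma> * t powr (- \<gamma> - 1)) * ennreal (\<omega> * t powr n)"
          by (rule mult_left_mono) simp
        also have "\<dots> = ennreal (\<gamma> * \<omega> * (t powr (- \<gamma> - 1) * t powr n))"
          using n \<omega> by (simp add: ennreal_mult[symmetric] ac_simps)
        also have "t powr (- \<gamma> - 1) * t powr n = t powr (n - \<gamma> - 1)"
          by (simp add: powr_add[symmetric] algebra_simps)
        finally show ?thesis using True R n \<omega> by (simp add: ennreal_mult)
      next
        case False
        then have "cball x t \<inter> - ball x R = {}" by auto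
        then show ?thesis by simp
      qed
    qed
    also have "\<dots> = ennreal (\<gamma> * \<omega>) * ennreal (R powr (n - \<gamma>) / (\<gamma> - n))"
      using n R nn_integral_powr_to_inf[of "n - \<gamma>" R] by (subst nn_integral_cmult) auto
    also have "\<dots> = ennreal (\<gamma> * \<omega> / (\<gamma> - n) * R powr (n - \<gamma>))"
      using n \<omega> by (simp add: ennreal_mult[symmetric])
    finally show "(\<integral>\<^sup>+y. ennreal (norm (x - y) powr - \<gamma>) * indicator (- ball x R) y \<partial>lborel)
      \<le> ennreal (\<gamma> * \<omega> / (\<gamma> - n) * R powr (real DIM('a) - \<gamma>))"
      by (simp add: n_def)
  qed
qed

section \<open>Distribution function of the potential\<close>

text \<open>At level \<open>t\<close> the kernel is cut at radius \<open>R ~ t powr (-b/n)\<close> and the density at height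
  \<open>\<tau> = c t powr (b/a)\<close>. Hoelder bounds the far part by \<open>t/3\<close>, the \<open>L\<^sup>1\<close> norm of the near
  kernel bounds the contribution of \<open>g \<le> \<tau>\<close> by \<open>t/3\<close>, and Markov's inequality controls the rest.\<close>
lemma riesz_distribution_bound:
  fixes \<alpha> a b :: real
  defines "n \<equiv> real DIM('a::euclidean_space)"
  assumes \<alpha>: "0 < \<alpha>" "\<alpha> < n" and a: "1 < a" "\<alpha> * a < n" and b: "1 / b = 1 / a - \<alpha> / n"
  obtains c where "0 < c" and "\<And>g :: 'a \<Rightarrow> ennreal. \<And>t. \<lbrakk>g \<in> borel_measurable borel;
    (\<integral>\<^sup>+y. epow (g y) a \<partial>lborel) \<le> 1; 0 < t\<rbrakk> \<Longrightarrow>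
    emeasure lborel {x. ennreal t < riesz \<alpha> g x}
      \<le> (\<integral>\<^sup>+y. ennreal (1 / (c * t powr (b / a))) * (g y * indicator {y. ennreal (c * t powr (b / a)) < g y} y) \<partial>lborel)"
proof -
  \<comment> \<open>\<open>a'\<close> is the conjugate exponent of \<open>a\<close>, and \<gamma>
    the decay exponent of the \<open>a'\<close>-th power of the kernel. The inequality
    \<open>n < \<gamma>\<close> is equivalent to \<open>\<alpha> * a < n\<close>.\<close>
  define a' where "a' = a / (a - 1)"
  define \<gamma> where "\<gamma> = (n - \<alpha>) * a'"
  have n: "0 < n" using \<alpha> by linarith
  have a': "1 < a'" "1 / a + 1 / a' = 1"
    using a by (auto simp: a'_def field_simps)
  have b_pos: "0 < b"
  proof -
    have "\<alpha> / n < 1 / a" using a n by (simp add: field_simps)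
    then have "0 < 1 / b" using b by simp
    then show ?thesis by simp
  qed
  have \<gamma>: "n < \<gamma>"
    using a n by (auto simp: \<gamma>_def a'_def field_simps)
  have far_exp: "(n - \<gamma>) / a' = - n / b"
  proof -
    have "(n - \<gamma>) / a' = n * (1 / a') - (n - \<alpha>)"
      using a' by (simp add: \<gamma>_def diff_divide_distrib)
    also have "1 / a' = 1 - 1 / a" using a' by simp
    also have "n * (1 - 1 / a) - (n - \<alpha>) = - n * (1 / a - \<alpha> / n)"
      using n by (simp add: right_diff_distrib)
    finally show ?thesis by (simp add: b[symmetric])
  qed
  have ba: "b / a = 1 + b * \<alpha> / n"
  proof -
    have "b * (1 / b) = b * (1 / a - \<alpha> / n)" using b by simp
    then show ?thesis using b_pos by (simp add: right_diff_distrib)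
  qed
  obtain Cn where Cn: "0 < Cn" "\<And>x::'a. \<And>R. 0 < R \<Longrightarrow>
    (\<integral>\<^sup>+y. ennreal (norm (x - y) powr (\<alpha> - n)) * indicator (ball x R) y \<partial>lborel) \<le> ennreal (Cn * R powr \<alpha>)"
    using nn_integral_kernel_ball[where 'a='a, of \<alpha>] \<alpha> unfolding n_def by metis
  obtain Cf where Cf: "0 < Cf" "\<And>x::'a. \<And>R. 0 < R \<Longrightarrow>
    (\<integral>\<^sup>+y. ennreal (norm (x - y) powr - \<gamma>) * indicator (- ball x R) y \<partial>lborel) \<le> ennreal (Cf * R powr (n - \<gamma>))"
    using nn_integral_kernel_outside_ball[where 'a='a, of \<gamma>] \<gamma> unfolding n_def by metis
  define D where "D = Cf powr (1 / a')"
  have D: "0 < D" using Cf by (simp add: D_def)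
  \<comment> \<open>With the radius fixed by the far part, \<open>c\<close> is solved from
    \<open>R_near\<close>, so that the near contribution of height \<tau> is exactly
    \<open>t / 3\<close>. The powers of \<open>t\<close> match because of \<open>ba\<close>.\<close>
  define c where "c = 1 / (3 * Cn * (3 * D) powr (b * \<alpha> / n))"
  show ?thesis
  proof (rule that[of c])
    show "0 < c" using Cn D by (simp add: c_def)
  next
    fix g :: "'a \<Rightarrow> ennreal" and t :: real
    assume g[measurable]: "g \<in> borel_measurable borel"
      and g1: "(\<integral>\<^sup>+y. epow (g y) a \<partial>lborel) \<le> 1" and t: "0 < t"
    \<comment> \<open>\<open>R\<close> is the solution of
      \<open>D * R powr (- n / b) = t / 3\<close>, whose left side is the Hoelder bound of the far
      part.\<close>
    define R where "R = (3 * D / t) powr (b / n)"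
    define \<tau> where "\<tau> = c * t powr (b / a)"
    have R: "0 < R" using D t by (simp add: R_def)
    have R_far: "D * R powr (- n / b) = t / 3"
      using D t n b_pos by (simp add: R_def powr_powr powr_minus_divide field_simps)
    have \<tau>_pos: "0 < \<tau>" using Cn D t by (simp add: \<tau>_def c_def)
    have R_near: "\<tau> * (Cn * R powr \<alpha>) = t / 3"
    proof -
      have "R powr \<alpha> = (3 * D / t) powr (b * \<alpha> / n)"
        by (simp add: R_def powr_powr)
      also have "\<dots> = (3 * D) powr (b * \<alpha> / n) / t powr (b * \<alpha> / n)"
        using D t by (simp add: powr_divide)
      finally have *: "R powr \<alpha> = (3 * D) powr (b * \<alpha> / n) / t powr (b * \<alpha> / n)" .
      have "t powr (b / a) = t * t powr (b * \<alpha> / n)"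
        using t by (simp add: ba powr_add)
      then show ?thesis
        unfolding * \<tau>_def c_def using Cn D t by simp
    qed
    let ?k = "\<lambda>x y :: 'a. ennreal (norm (x - y) powr (\<alpha> - n))"
    let ?g\<tau> = "\<lambda>y. g y * indicator {y. ennreal \<tau> < g y} y"
    \<comment> \<open>Near potential of the part of \<open>g\<close> above \<tau>. The cutoff is
      written through \<open>dist x y\<close>, which shows it as a jointly measurable, symmetric
      function for Fubini.\<close>
    define H where "H x = (\<integral>\<^sup>+y. ?g\<tau> y * (?k x y * indicator {..<R} (dist x y)) \<partial>lborel)" for x
    have [measurable]: "{y. ennreal \<tau> < g y} \<in> sets borel" by measurable
    have [measurable]: "ball x R \<in> sets borel" "- ball x R \<in> sets borel" for x :: 'a
      by auto
    have k_meas [measurable]: "(\<lambda>y. ?k x y * indicator (- ball x R) y) \<in> borel_measurable borel"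
        "(\<lambda>y. ?k x y * indicator (ball x R) y) \<in> borel_measurable borel"
        "(\<lambda>y. ?k x y * indicator {..<R} (dist x y)) \<in> borel_measurable borel" for x
      by measurable
    have far: "(\<integral>\<^sup>+y. g y * (?k x y * indicator (- ball x R) y) \<partial>lborel) \<le> ennreal (t / 3)" for x
    proof -
      have "(\<integral>\<^sup>+y. g y * (?k x y * indicator (- ball x R) y) \<partial>lborel)
        \<le> epow (\<integral>\<^sup>+y. epow (g y) a \<partial>lborel) (1 / a)
          * epow (\<integral>\<^sup>+y. epow (?k x y * indicator (- ball x R) y) a' \<partial>lborel) (1 / a')"
        by (rule nn_integral_Holder) (use a a' in auto)
      also have "\<dots> \<le> 1 * epow (ennreal (Cf * R powr (n - \<gamma>))) (1 / a')"
      proof (intro mult_mono epow_mono)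
        show "epow (\<integral>\<^sup>+y. epow (g y) a \<partial>lborel) (1 / a) \<le> 1"
          using epow_mono[OF g1, of "1 / a"] a epow_ennreal[of 1 "1 / a"] by simp
        have "(\<integral>\<^sup>+y. epow (?k x y * indicator (- ball x R) y) a' \<partial>lborel)
            = (\<integral>\<^sup>+y. ennreal (norm (x - y) powr - \<gamma>) * indicator (- ball x R) y \<partial>lborel)"
          by (intro nn_integral_cong)
             (auto split: split_indicator simp: powr_powr \<gamma>_def algebra_simps)
        also have "\<dots> \<le> ennreal (Cf * R powr (n - \<gamma>))" using Cf R by blast
        finally show "(\<integral>\<^sup>+y. epow (?k x y * indicator (- ball x R) y) a' \<partial>lborel) \<le> ennreal (Cf * R powr (n - \<gamma>))" .
      qed (use a' in auto)
      also have "\<dots> = ennreal (D * R powr ((n - \<gamma>) / a'))"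
        using Cf by (simp add: powr_mult powr_powr D_def)
      finally show ?thesis
        unfolding far_exp R_far .
    qed
    have riesz_le: "riesz \<alpha> g x \<le> ennreal (2 * t / 3) + H x" for x
    proof -
      have "riesz \<alpha> g x \<le> (\<integral>\<^sup>+y. g y * (?k x y * indicator (- ball x R) y)
          + (ennreal \<tau> * (?k x y * indicator (ball x R) y)
          + ?g\<tau> y * (?k x y * indicator {..<R} (dist x y))) \<partial>lborel)"
        unfolding riesz_def n_def[symmetric]
      proof (intro nn_integral_mono)
        fix y
        show "g y * ?k x y \<le> g y * (?k x y * indicator (- ball x R) y)
          + (ennreal \<tau> * (?k x y * indicator (ball x R) y)
          + ?g\<tau> y * (?k x y * indicator {..<R} (dist x y)))"
          by (auto split: split_indicator intro: mult_right_mono)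
      qed
      also have "\<dots> = (\<integral>\<^sup>+y. g y * (?k x y * indicator (- ball x R) y) \<partial>lborel)
          + (ennreal \<tau> * (\<integral>\<^sup>+y. ?k x y * indicator (ball x R) y \<partial>lborel) + H x)"
        unfolding H_def using k_meas[of x] by (simp add: nn_integral_add nn_integral_cmult)
      also have "\<dots> \<le> ennreal (t / 3) + (ennreal \<tau> * ennreal (Cn * R powr \<alpha>) + H x)"
        by (intro add_mono far mult_left_mono Cn R) auto
      also have "ennreal \<tau> * ennreal (Cn * R powr \<alpha>) = ennreal (\<tau> * (Cn * R powr \<alpha>))"
        using \<tau>_pos Cn by (simp add: ennreal_mult)
      also have "\<tau> * (Cn * R powr \<alpha>) = t / 3"
        by (rule R_near)
      also have "ennreal (t / 3) + (ennreal (t / 3) + H x) = ennreal (2 * t / 3) + H x"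
        using t by (simp add: add.assoc[symmetric] ennreal_plus[symmetric] del: ennreal_plus)
      finally show ?thesis .
    qed
    have H_meas [measurable]: "H \<in> borel_measurable borel"
    proof -
      have "(\<lambda>x. \<integral>\<^sup>+y. ?g\<tau> y * (?k x y * indicator {..<R} (dist x y)) \<partial>lborel) \<in> borel_measurable lborel"
        by measurable
      then show ?thesis by (simp add: H_def[abs_def])
    qed
    have H_int: "(\<integral>\<^sup>+x. H x \<partial>lborel) \<le> ennreal (Cn * R powr \<alpha>) * (\<integral>\<^sup>+y. ?g\<tau> y \<partial>lborel)"
    proof -
      have "(\<integral>\<^sup>+x. H x \<partial>lborel) = (\<integral>\<^sup>+y. (\<integral>\<^sup>+x. ?g\<tau> y * (?k x y * indicator {..<R} (dist x y)) \<partial>lborel) \<partial>lborel)"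
        unfolding H_def by (rule lborel_pair.Fubini') measurable
      also have "\<dots> = (\<integral>\<^sup>+y. ?g\<tau> y * (\<integral>\<^sup>+x. ?k y x * indicator (ball y R) x \<partial>lborel) \<partial>lborel)"
        by (intro nn_integral_cong, subst nn_integral_cmult[symmetric])
           (auto split: split_indicator simp: norm_minus_commute dist_commute k_meas intro!: nn_integral_cong)
      also have "\<dots> \<le> (\<integral>\<^sup>+y. ?g\<tau> y * ennreal (Cn * R powr \<alpha>) \<partial>lborel)"
        by (intro nn_integral_mono mult_left_mono Cn R) auto
      also have "\<dots> = ennreal (Cn * R powr \<alpha>) * (\<integral>\<^sup>+y. ?g\<tau> y \<partial>lborel)"
        by (subst nn_integral_multc) (auto simp: mult.commute)
      finally show ?thesis .
    qed
    \<comment> \<open>The other two parts total at most \<open>2 * t / 3\<close>, so a value above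
      \<open>t\<close> forces \<open>H\<close> to be at least \<open>t / 3\<close>. In the Markov
      bound that follows, \<open>R_near\<close> turns the constant into
      \<open>1 / \<tau>\<close>.\<close>
    have "{x. ennreal t < riesz \<alpha> g x} \<subseteq> {x\<in>UNIV. 1 \<le> ennreal (3 / t) * H x}"
    proof safe
      fix x assume less: "ennreal t < riesz \<alpha> g x"
      have "ennreal (t / 3) \<le> H x"
      proof (rule ccontr)
        assume "\<not> ennreal (t / 3) \<le> H x"
        then have "ennreal (2 * t / 3) + H x \<le> ennreal (2 * t / 3) + ennreal (t / 3)"
          by (intro add_left_mono) auto
        also have "\<dots> = ennreal t"
          using t by (simp add: ennreal_plus[symmetric] del: ennreal_plus)
        finally show False using less riesz_le[of x] by (auto dest: leD order_trans)
      qed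
      then have "ennreal (3 / t) * ennreal (t / 3) \<le> ennreal (3 / t) * H x"
        by (intro mult_left_mono) auto
      then show "1 \<le> ennreal (3 / t) * H x"
        using t by (simp add: ennreal_mult[symmetric])
    qed simp
    then have "emeasure lborel {x. ennreal t < riesz \<alpha> g x} \<le> emeasure lborel {x\<in>UNIV. 1 \<le> ennreal (3 / t) * H x}"
      by (intro emeasure_mono) auto
    also have "\<dots> \<le> ennreal (3 / t) * (\<integral>\<^sup>+x. H x * indicator UNIV x \<partial>lborel)"
      using nn_integral_Markov_inequality[of H UNIV lborel "ennreal (3 / t)"] by simp
    also have "\<dots> \<le> ennreal (3 / t) * (ennreal (Cn * R powr \<alpha>) * (\<integral>\<^sup>+y. ?g\<tau> y \<partial>lborel))"
      using H_int by (intro mult_left_mono) auto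
    also have "\<dots> = ennreal (1 / \<tau>) * (\<integral>\<^sup>+y. ?g\<tau> y \<partial>lborel)"
    proof -
      have "3 / t * (Cn * R powr \<alpha>) = 1 / \<tau>"
        using R_near \<tau>_pos t by (simp add: field_simps)
      then show ?thesis
        using t Cn by (simp add: mult.assoc[symmetric] ennreal_mult[symmetric])
    qed
    also have "\<dots> = (\<integral>\<^sup>+y. ennreal (1 / \<tau>) * ?g\<tau> y \<partial>lborel)"
      by (rule nn_integral_cmult[symmetric]) measurable
    finally show "emeasure lborel {x. ennreal t < riesz \<alpha> g x}
      \<le> (\<integral>\<^sup>+y. ennreal (1 / (c * t powr (b / a))) * (g y * indicator {y. ennreal (c * t powr (b / a)) < g y} y) \<partial>lborel)"
      by (simp add: \<tau>_def)
  qed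
qed

section \<open>The Hardy-Littlewood-Sobolev inequality\<close>

text \<open>The \<open>a\<close>-th power of the L^a norm. Without the root, integral theorems apply
  directly, and scaling by \<open>c\<close> produces the factor \<open>epow c a\<close>.\<close>

definition mass :: "real \<Rightarrow> ('a::euclidean_space \<Rightarrow> ennreal) \<Rightarrow> ennreal" where
  "mass a f = (\<integral>\<^sup>+x. epow (f x) a \<partial>lborel)"

lemma mass_mono: "(\<And>x. f x \<le> g x) \<Longrightarrow> 0 \<le> a \<Longrightarrow> mass a f \<le> mass a g"
  unfolding mass_def by (intro nn_integral_mono epow_mono) auto

lemma mass_cmult:
  assumes [measurable]: "f \<in> borel_measurable borel"
  shows "mass a (\<lambda>x. c * f x) = epow c a * mass a f"
  unfolding mass_def epow_mult by (rule nn_integral_cmult) measurable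

lemma mass_epow: "mass a (\<lambda>x. epow (f x) p) = mass (p * a) f"
  unfolding mass_def epow_epow ..

lemma mass_add_le:
  assumes [measurable]: "f \<in> borel_measurable borel" "g \<in> borel_measurable borel" and a: "0 < a"
  shows "mass a (\<lambda>x. f x + g x) \<le> ennreal (2 powr a) * (mass a f + mass a g)"
proof -
  have "mass a (\<lambda>x. f x + g x) \<le> (\<integral>\<^sup>+x. ennreal (2 powr a) * (epow (f x) a + epow (g x) a) \<partial>lborel)"
    unfolding mass_def by (intro nn_integral_mono epow_add_le a)
  also have "\<dots> = ennreal (2 powr a) * (mass a f + mass a g)"
    by (simp add: nn_integral_cmult nn_integral_add mass_def)
  finally show ?thesis .
qed

text \<open>A Marcinkiewicz argument with a threshold moving with \<open>t\<close>: integrate the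
  distribution bound against \<open>b * t powr (b - 1)\<close> and exchange the integrals. Where the
  density has the value \<open>G\<close>, only levels \<open>t < (G / c) powr (a / b)\<close>
  contribute, and their total is a multiple of \<open>epow G a\<close>.\<close>

lemma riesz_strong_bound_normalized:
  fixes \<alpha> a b :: real
  defines "n \<equiv> real DIM('a::euclidean_space)"
  assumes \<alpha>: "0 < \<alpha>" "\<alpha> < n" and a: "1 < a" "\<alpha> * a < n" and b: "1 / b = 1 / a - \<alpha> / n"
  obtains C where "0 < C" and "\<And>g :: 'a \<Rightarrow> ennreal. g \<in> borel_measurable borel \<Longrightarrow>
    mass a g \<le> 1 \<Longrightarrow> mass b (riesz \<alpha> g) \<le> ennreal C"
proof -
  have n: "0 < n" using \<alpha> by linarith
  have b_pos: "0 < b"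
  proof -
    have "\<alpha> / n < 1 / a" using a n by (simp add: field_simps)
    then have "0 < 1 / b" using b by simp
    then show ?thesis by simp
  qed
  obtain c where c: "0 < c" and dist: "\<And>g :: 'a \<Rightarrow> ennreal. \<And>t. \<lbrakk>g \<in> borel_measurable borel;
    (\<integral>\<^sup>+y. epow (g y) a \<partial>lborel) \<le> 1; 0 < t\<rbrakk> \<Longrightarrow>
    emeasure lborel {x. ennreal t < riesz \<alpha> g x}
      \<le> (\<integral>\<^sup>+y. ennreal (1 / (c * t powr (b / a))) * (g y * indicator {y. ennreal (c * t powr (b / a)) < g y} y) \<partial>lborel)"
    by (rule riesz_distribution_bound[where 'a='a, OF \<alpha>[unfolded n_def] a(1) a(2)[unfolded n_def] b[unfolded n_def]])
      (rule that, assumption+)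
  \<comment> \<open>After division by \<open>t powr (b / a)\<close> the weight has exponent
    \<open>e - 1\<close>, integrable at 0 since \<open>1 < a\<close>. The identity
    \<open>a / b * e = a - 1\<close> together with the remaining factor \<open>G\<close> yields the
    power \<open>a\<close>.\<close>
  define e where "e = b - b / a"
  have e: "0 < e" "a / b * e = a - 1"
    using a b_pos by (simp_all add: e_def right_diff_distrib field_simps)
  define C where "C = b / c / e * (1 / c) powr (a - 1)"
  have C: "0 < C" using b_pos c e by (simp add: C_def)
  show ?thesis
  proof (rule that[of C])
    show "0 < C" by (rule C)
  next
    fix g :: "'a \<Rightarrow> ennreal"
    assume g[measurable]: "g \<in> borel_measurable borel" and g1: "mass a g \<le> 1"
    let ?D = "\<lambda>t G. ennreal (b * t powr (b - 1)) * indicator {0<..} t *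
          (ennreal (1 / (c * t powr (b / a))) * (G * indicator {G. ennreal (c * t powr (b / a)) < G} G))"
    have inner: "(\<integral>\<^sup>+t. ?D t G \<partial>lborel) \<le> ennreal C * epow G a" for G
    proof (cases G)
      case top
      then show ?thesis using C by (simp add: ennreal_mult_top)
    next
      case (real r)
      have "(\<integral>\<^sup>+t. ?D t G \<partial>lborel)
          = (\<integral>\<^sup>+t. ennreal (b / c * r) * (ennreal (t powr (e - 1)) * indicator {0<..<(r / c) powr (a / b)} t) \<partial>lborel)"
      proof (intro nn_integral_cong)
        fix t :: real
        show "?D t G = ennreal (b / c * r) * (ennreal (t powr (e - 1)) * indicator {0<..<(r / c) powr (a / b)} t)"
        proof (cases "0 < t")
          case True
          have "c * t powr (b / a) < r \<longleftrightarrow> t powr (b / a) < r / c"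
            using c by (simp add: field_simps)
          also have "\<dots> \<longleftrightarrow> t < (r / c) powr (a / b)"
          proof
            assume "t powr (b / a) < r / c"
            then have "(t powr (b / a)) powr (a / b) < (r / c) powr (a / b)"
              using a b_pos by (intro powr_less_mono2) auto
            then show "t < (r / c) powr (a / b)"
              using True a b_pos by (simp add: powr_powr)
          next
            assume "t < (r / c) powr (a / b)"
            then have "t powr (b / a) < ((r / c) powr (a / b)) powr (b / a)"
              using a b_pos True by (intro powr_less_mono2) auto
            then show "t powr (b / a) < r / c"
              using a b_pos real c by (simp add: powr_powr)
          qed
          finally have iff: "c * t powr (b / a) < r \<longleftrightarrow> t < (r / c) powr (a / b)" .
          have "b * t powr (b - 1) * (1 / (c * t powr (b / a)) * r) = b / c * r * (t powr (b - 1) / t powr (b / a))"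
            by simp
          also have "t powr (b - 1) / t powr (b / a) = t powr (e - 1)"
            by (simp add: powr_diff[symmetric] e_def algebra_simps)
          finally show ?thesis
            using True iff real b_pos c
            by (auto simp: ennreal_mult[symmetric] ennreal_less_iff split: split_indicator)
        qed simp
      qed
      also have "\<dots> = ennreal (b / c * r) * ennreal (((r / c) powr (a / b)) powr e / e)"
        using e by (subst nn_integral_cmult) (auto simp: nn_integral_powr_from_0)
      also have "\<dots> = ennreal (C * r powr a)"
      proof -
        have "((r / c) powr (a / b)) powr e = r powr (a - 1) * (1 / c) powr (a - 1)"
          using real c e by (simp add: powr_powr powr_mult[symmetric])
        moreover have "r * r powr (a - 1) = r powr a"
          using real powr_mult_base[of r "a - 1"] by simp
        ultimately have "b / c * r * (((r / c) powr (a / b)) powr e / e) = C * r powr a"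
          by (simp add: C_def)
        then show ?thesis
          using real b_pos c e by (simp add: ennreal_mult[symmetric])
      qed
      finally show ?thesis
        using real C by (simp add: ennreal_mult)
    qed
    have "mass b (riesz \<alpha> g) = (\<integral>\<^sup>+x. (\<integral>\<^sup>+t. ennreal (b * t powr (b - 1)) * indicator {t. 0 < t \<and> ennreal t < riesz \<alpha> g x} t \<partial>lborel) \<partial>lborel)"
      unfolding mass_def epow_layer_cake[OF b_pos] ..
    also have "\<dots> = (\<integral>\<^sup>+t. (\<integral>\<^sup>+x. ennreal (b * t powr (b - 1)) * indicator {t. 0 < t \<and> ennreal t < riesz \<alpha> g x} t \<partial>lborel) \<partial>lborel)"
      by (rule lborel_pair.Fubini') measurable
    also have "\<dots> = (\<integral>\<^sup>+t. (\<integral>\<^sup>+x. ennreal (b * t powr (b - 1)) * indicator {0<..} t * indicator {x. ennreal t < riesz \<alpha> g x} x \<partial>lborel) \<partial>lborel)"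
      by (intro nn_integral_cong) (auto split: split_indicator)
    also have "\<dots> = (\<integral>\<^sup>+t. ennreal (b * t powr (b - 1)) * indicator {0<..} t * emeasure lborel {x. ennreal t < riesz \<alpha> g x} \<partial>lborel)"
      by (intro nn_integral_cong nn_integral_cmult_indicator) measurable
    also have "\<dots> \<le> (\<integral>\<^sup>+t. ennreal (b * t powr (b - 1)) * indicator {0<..} t *
        (\<integral>\<^sup>+y. ennreal (1 / (c * t powr (b / a))) * (g y * indicator {G. ennreal (c * t powr (b / a)) < G} (g y)) \<partial>lborel) \<partial>lborel)"
    proof (intro nn_integral_mono)
      fix t :: real
      show "ennreal (b * t powr (b - 1)) * indicator {0<..} t * emeasure lborel {x. ennreal t < riesz \<alpha> g x}
        \<le> ennreal (b * t powr (b - 1)) * indicator {0<..} t *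
        (\<integral>\<^sup>+y. ennreal (1 / (c * t powr (b / a))) * (g y * indicator {G. ennreal (c * t powr (b / a)) < G} (g y)) \<partial>lborel)"
        using dist[OF g g1[unfolded mass_def], of t]
        by (cases "0 < t") (auto intro!: mult_left_mono simp: indicator_def)
    qed
    also have "\<dots> = (\<integral>\<^sup>+t. (\<integral>\<^sup>+y. ?D t (g y) \<partial>lborel) \<partial>lborel)"
      by (intro nn_integral_cong nn_integral_cmult[symmetric]) measurable
    also have "\<dots> = (\<integral>\<^sup>+y. (\<integral>\<^sup>+t. ?D t (g y) \<partial>lborel) \<partial>lborel)"
      by (rule lborel_pair.Fubini') measurable
    also have "\<dots> \<le> (\<integral>\<^sup>+y. ennreal C * epow (g y) a \<partial>lborel)"
      by (intro nn_integral_mono inner)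
    also have "\<dots> = ennreal C * mass a g"
      unfolding mass_def by (rule nn_integral_cmult) measurable
    also have "\<dots> \<le> ennreal C * 1"
      using g1 by (rule mult_left_mono) simp
    finally show "mass b (riesz \<alpha> g) \<le> ennreal C" by simp
  qed
qed

text \<open>Homogeneity reduces a positive finite mass to mass 1. Zero mass makes the potential
  vanish, and infinite mass makes the right side infinite.\<close>

theorem Hardy_Littlewood_Sobolev:
  fixes \<alpha> a b :: real
  defines "n \<equiv> real DIM('a::euclidean_space)"
  assumes \<alpha>: "0 < \<alpha>" "\<alpha> < n" and a: "1 < a" "\<alpha> * a < n" and b: "1 / b = 1 / a - \<alpha> / n"
  obtains C where "0 < C" and "\<And>g :: 'a \<Rightarrow> ennreal. g \<in> borel_measurable borel \<Longrightarrow>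
    mass b (riesz \<alpha> g) \<le> ennreal C * epow (mass a g) (b / a)"
proof -
  obtain C where C: "0 < C" and bound: "\<And>g :: 'a \<Rightarrow> ennreal. g \<in> borel_measurable borel \<Longrightarrow>
    mass a g \<le> 1 \<Longrightarrow> mass b (riesz \<alpha> g) \<le> ennreal C"
    using riesz_strong_bound_normalized[where 'a='a, OF \<alpha>[unfolded n_def] a(1) a(2)[unfolded n_def] b[unfolded n_def]] by metis
  show ?thesis
  proof (rule that[of C])
    show "0 < C" by (rule C)
  next
    fix g :: "'a \<Rightarrow> ennreal"
    assume g[measurable]: "g \<in> borel_measurable borel"
    consider "mass a g = 0" | "mass a g = top" | G where "0 < G" "mass a g = ennreal G"
    proof (cases "mass a g")
      case (real r)
      then show ?thesis
        using that(1) that(3)[of r] by (cases "r = 0") auto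
    qed (use that in auto)
    then show "mass b (riesz \<alpha> g) \<le> ennreal C * epow (mass a g) (b / a)"
    proof cases
      case 1
      then have "AE y in lborel. g y = 0"
        by (simp add: mass_def nn_integral_0_iff_AE)
      then have "riesz \<alpha> g x = (\<integral>\<^sup>+y. 0 \<partial>(lborel :: 'a measure))" for x
        unfolding riesz_def by (intro nn_integral_cong_AE) auto
      then show ?thesis by (simp add: mass_def)
    next
      case 2
      then show ?thesis using C by (simp add: ennreal_mult_top)
    next
      case 3
      define s where "s = G powr (1 / a)"
      have s: "0 < s" "s powr a = G" "s powr b = G powr (b / a)"
        using 3 a by (auto simp: s_def powr_powr)
      define h where "h = (\<lambda>y. ennreal (1 / s) * g y)"
      have h[measurable]: "h \<in> borel_measurable borel" unfolding h_def by measurable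
      have g_eq: "g = (\<lambda>y. ennreal s * h y)"
        using s by (simp add: h_def fun_eq_iff mult.assoc[symmetric] ennreal_mult[symmetric])
      have "mass a h = 1"
        using s 3 by (simp add: h_def mass_cmult powr_divide ennreal_mult[symmetric])
      then have "mass b (riesz \<alpha> h) \<le> ennreal C" by (intro bound) auto
      moreover have "mass b (riesz \<alpha> g) = ennreal (s powr b) * mass b (riesz \<alpha> h)"
      proof -
        have "riesz \<alpha> g = (\<lambda>x. ennreal s * riesz \<alpha> h x)"
          by (rule ext, subst g_eq, rule riesz_cmult[OF h])
        then show ?thesis
          using s by (simp add: mass_cmult)
      qed
      ultimately have "mass b (riesz \<alpha> g) \<le> ennreal (s powr b) * ennreal C"
        by (simp add: mult_left_mono)
      then show ?thesis using 3 s by (simp add: mult.commute)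
    qed
  qed
qed

section \<open>Regularity lifting\<close>

text \<open>Exponents are recorded by their reciprocals, on which the potential acts as subtraction
  of \<open>\<alpha> / n\<close>. This form serves the exponent arithmetic of the final
  proof.\<close>

lemma mass_riesz_finite:
  fixes g :: "'a::euclidean_space \<Rightarrow> ennreal"
  defines "n \<equiv> real DIM('a)"
  assumes \<alpha>: "0 < \<alpha>" "\<alpha> < n" and \<rho>: "0 < \<rho>" "\<rho> + \<alpha> / n < 1"
    and g: "g \<in> borel_measurable borel" "mass (1 / (\<rho> + \<alpha> / n)) g < top"
  shows "mass (1 / \<rho>) (riesz \<alpha> g) < top"
proof -
  have n: "0 < n" using \<alpha> by linarith
  then have t: "0 < \<alpha> / n" using \<alpha> by simp
  define a where "a = 1 / (\<rho> + \<alpha> / n)"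
  have "1 < a" using \<rho> t by (simp add: a_def)
  moreover have "\<alpha> * a < n"
  proof -
    have "\<alpha> * 1 < n * (\<rho> + \<alpha> / n)" using n \<rho> by (simp add: distrib_left)
    then show ?thesis using \<rho> t by (simp add: a_def pos_divide_less_eq add_pos_pos)
  qed
  moreover have "1 / (1 / \<rho>) = 1 / a - \<alpha> / n" by (simp add: a_def)
  ultimately obtain C where "mass (1 / \<rho>) (riesz \<alpha> g) \<le> ennreal C * epow (mass a g) ((1 / \<rho>) / a)"
    using Hardy_Littlewood_Sobolev[where 'a='a, of \<alpha> a "1 / \<rho>"] \<alpha> g(1) unfolding n_def by blast
  also have "\<dots> < top"
    using g(2) by (simp add: ennreal_mult_less_top a_def)
  finally show ?thesis .
qed

text \<open>The iterates satisfy \<open>u \<le> w\<^sub>k + z\<^sub>k\<close> with \<open>w\<^sub>k\<close> increasing and bounded in \<open>L\<^sup>r\<close> and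
  \<open>z\<^sub>k\<close> tending to zero in \<open>L\<^bsup>r\<^sub>0\<^esup>\<close>, so that \<open>u \<le> sup w\<^sub>k\<close> almost everywhere.\<close>
lemma lifting_by_iteration:
  fixes u F :: "'a::euclidean_space \<Rightarrow> ennreal" and T S :: "('a \<Rightarrow> ennreal) \<Rightarrow> 'a \<Rightarrow> ennreal"
  assumes u[measurable]: "u \<in> borel_measurable borel" and F[measurable]: "F \<in> borel_measurable borel"
    and S_meas: "\<And>f. f \<in> borel_measurable borel \<Longrightarrow> S f \<in> borel_measurable borel"
    and T_mono: "\<And>f g x. (\<And>y. f y \<le> g y) \<Longrightarrow> T f x \<le> T g x"
    and S_mono: "\<And>f g x. (\<And>y. f y \<le> g y) \<Longrightarrow> S f x \<le> S g x"
    and T_add: "\<And>f g x. f \<in> borel_measurable borel \<Longrightarrow> g \<in> borel_measurable borel \<Longrightarrow>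
                  T (\<lambda>y. f y + g y) x \<le> S f x + S g x"
    and r: "0 < r" and r0: "0 < r0"
    and S_r: "\<And>f. f \<in> borel_measurable borel \<Longrightarrow> mass r (S f) \<le> ennreal (1 / (2 * 2 powr r)) * mass r f"
    and S_r0: "\<And>f. f \<in> borel_measurable borel \<Longrightarrow> mass r0 (S f) \<le> ennreal (1 / 2) * mass r0 f"
    and u_le: "\<And>x. u x \<le> F x + T u x"
    and F_fin: "mass r F < top" and u_fin: "mass r0 u < top"
  shows "mass r u < top"
proof -
  \<comment> \<open>\<open>w\<close> iterates \<open>F + S f\<close> from 0 and \<open>z\<close>
    iterates \<open>S\<close> from \<open>u\<close>. The map \<open>S\<close> carries the loss
    incurred when \<open>T\<close> is split over a sum.\<close>
  define w where "w = rec_nat (\<lambda>_. 0) (\<lambda>_ f x. F x + S f x)"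
  define z where "z = rec_nat u (\<lambda>_. S)"
  have w: "w 0 = (\<lambda>_. 0)" "w (Suc k) = (\<lambda>x. F x + S (w k) x)" for k
    by (simp_all add: w_def)
  have z: "z 0 = u" "z (Suc k) = S (z k)" for k
    by (simp_all add: z_def)
  have w_meas[measurable]: "w k \<in> borel_measurable borel" for k
  proof (induction k)
    case (Suc k)
    note [measurable] = S_meas[OF Suc]
    show ?case unfolding w by measurable
  qed (simp add: w)
  have z_meas[measurable]: "z k \<in> borel_measurable borel" for k
    by (induction k) (simp_all add: z S_meas)
  have u_wz: "u x \<le> w k x + z k x" for k x
  proof (induction k arbitrary: x)
    case (Suc k)
    have "u x \<le> F x + T u x" by (rule u_le)
    also have "T u x \<le> T (\<lambda>y. w k y + z k y) x"
      by (rule T_mono) (rule Suc)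
    also have "\<dots> \<le> S (w k) x + S (z k) x"
      by (rule T_add) measurable
    finally show ?case by (simp add: w z add.assoc add_left_mono)
  qed (simp add: w z)
  have w_step: "w k x \<le> w (Suc k) x" for k x
    by (induction k arbitrary: x) (auto simp: w intro!: add_left_mono S_mono)
  \<comment> \<open>\<open>B\<close> solves \<open>B = 2 powr r * mass r F + B / 2\<close>: the
    factor assumed for \<open>S\<close> is half the reciprocal of the quasi-triangle constant
    \<open>2 powr r\<close>, so the bound reproduces itself.\<close>
  define B where "B = 2 * (ennreal (2 powr r) * mass r F)"
  have w_bound: "mass r (w k) \<le> B" for k
  proof (induction k)
    case (Suc k)
    have "mass r (w (Suc k)) \<le> ennreal (2 powr r) * (mass r F + mass r (S (w k)))"
      unfolding w using S_meas[OF w_meas] r by (intro mass_add_le) auto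
    also have "\<dots> \<le> ennreal (2 powr r) * (mass r F + ennreal (1 / (2 * 2 powr r)) * B)"
      by (intro mult_left_mono add_left_mono order_trans[OF S_r[OF w_meas]] Suc) auto
    also have "\<dots> = ennreal (2 powr r) * mass r F + ennreal (2 powr r * (1 / (2 * 2 powr r))) * B"
      by (simp add: distrib_left mult.assoc[symmetric] ennreal_mult[symmetric])
    also have "ennreal (2 powr r * (1 / (2 * 2 powr r))) * B = ennreal (2 powr r) * mass r F"
    proof -
      have "ennreal (2 powr r * (1 / (2 * 2 powr r))) * 2 = ennreal (2 powr r * (1 / (2 * 2 powr r)) * 2)"
        by (subst ennreal_mult) auto
      also have "\<dots> = 1" by simp
      finally show ?thesis by (simp add: B_def mult.assoc[symmetric])
    qed
    finally show ?case by (simp add: B_def mult_2)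
  qed (simp add: w mass_def)
  define W where "W x = (SUP k. w k x)" for x
  have "mass r W = (\<integral>\<^sup>+x. (SUP k. epow (w k x) r) \<partial>lborel)"
    unfolding mass_def W_def using r by (simp add: epow_SUP)
  also have "\<dots> = (SUP k. mass r (w k))"
    unfolding mass_def
    by (intro nn_integral_monotone_convergence_SUP)
       (use r in \<open>auto simp: incseq_Suc_iff le_fun_def intro!: epow_mono w_step\<close>)
  also have "\<dots> \<le> B" by (intro SUP_least w_bound)
  also have "B < top" using F_fin by (simp add: B_def ennreal_mult_less_top)
  finally have W_fin: "mass r W < top" .
  have z_bound: "mass r0 (z k) \<le> ennreal ((1 / 2) ^ k) * mass r0 u" for k
  proof (induction k)
    case (Suc k)
    have "mass r0 (z (Suc k)) \<le> ennreal (1 / 2) * mass r0 (z k)"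
      unfolding z by (rule S_r0) measurable
    also have "\<dots> \<le> ennreal (1 / 2) * (ennreal ((1 / 2) ^ k) * mass r0 u)"
      by (intro mult_left_mono Suc) auto
    also have "\<dots> = ennreal ((1 / 2) ^ Suc k) * mass r0 u"
      by (subst mult.assoc[symmetric], subst ennreal_mult[symmetric]) auto
    finally show ?case .
  qed (simp add: z)
  \<comment> \<open>The infimum replaces a limit of the \<open>z k\<close>. Its mass lies below
    every \<open>(1 / 2) ^ k * M\<close>, so it vanishes almost everywhere.\<close>
  define Z where "Z x = (INF k. z k x)" for x
  have Z_meas[measurable]: "Z \<in> borel_measurable borel"
    unfolding Z_def[abs_def] by measurable
  obtain M where M: "0 \<le> M" "mass r0 u = ennreal M"
    using u_fin by (cases "mass r0 u") auto
  have "mass r0 Z \<le> ennreal ((1 / 2) ^ k * M)" for k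
  proof -
    have "mass r0 Z \<le> mass r0 (z k)"
      using r0 by (intro mass_mono) (auto simp: Z_def intro: INF_lower)
    with z_bound[of k] M show ?thesis by (simp add: ennreal_mult[symmetric])
  qed
  moreover have "(\<lambda>k. ennreal ((1 / 2) ^ k * M)) \<longlonglongrightarrow> ennreal (0 * M)"
    by (intro tendsto_ennrealI tendsto_mult LIMSEQ_power_zero tendsto_const) auto
  ultimately have "mass r0 Z \<le> ennreal (0 * M)"
    by (intro LIMSEQ_le_const) auto
  then have "AE x in lborel. Z x = 0"
    by (simp add: mass_def nn_integral_0_iff_AE)
  then have "AE x in lborel. epow (u x) r \<le> epow (W x) r"
  proof eventually_elim
    case (elim x)
    have "u x \<le> W x"
    proof (rule ccontr)
      assume *: "\<not> u x \<le> W x"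
      \<comment> \<open>Here \<open>W x < u x\<close>, so \<open>W x\<close> is finite and may be
        subtracted. The difference lies below every \<open>z k x\<close>, hence below
        \<open>Z x = 0\<close>.\<close>
      have "u x - W x \<le> z k x" for k
      proof -
        have "u x \<le> W x + z k x"
          using u_wz[of x k] by (rule order_trans) (auto simp: W_def intro: add_right_mono SUP_upper)
        then show ?thesis using * by (auto simp: ennreal_minus_le_iff)
      qed
      then have "u x - W x \<le> Z x" unfolding Z_def by (intro INF_greatest)
      then show False
        using elim * by (simp only: ennreal_minus_le_iff) auto
    qed
    then show ?case using r by (intro epow_mono) auto
  qed
  then have "mass r u \<le> mass r W"
    unfolding mass_def by (rule nn_integral_mono_AE)
  with W_fin show ?thesis by simp
qed

text \<open>With \<open>r = 1 / \<rho>\<close>, the Hardy-Littlewood-Sobolev inequality sends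
  \<open>epow f p\<close> from L^(r/p) to L^s, Hoelder with the factor in \<open>V\<close> lands in
  L^a, and a second potential returns to L^r. The three bounds on \<rho> say that \<open>s\<close>
  is positive, that \<open>1 < r / p\<close> and that \<open>1 < a\<close>.\<close>

lemma lifting_operator_bound:
  fixes \<alpha> p q \<rho> :: real
  defines "n \<equiv> real DIM('a::euclidean_space)"
  defines "s\<^sub>0 \<equiv> n * (p * q - 1) / (\<alpha> * (p + 1))"
  assumes \<alpha>: "0 < \<alpha>" "\<alpha> < n" and pq: "0 < p" "1 < p * q"
    and \<rho>: "\<alpha> / (p * n) < \<rho>" "\<rho> < 1 / p" "\<rho> + \<alpha> / n < 1"
  obtains C \<theta> where "0 < C" "0 < \<theta>" and "\<And>V f :: 'a \<Rightarrow> ennreal. V \<in> borel_measurable borel \<Longrightarrow> f \<in> borel_measurable borel \<Longrightarrow>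
     mass (1 / \<rho>) (riesz \<alpha> (\<lambda>x. epow (V x) (q - 1 / p) * epow (riesz \<alpha> (\<lambda>y. epow (f y) p) x) (1 / p)))
       \<le> ennreal C * epow (mass s\<^sub>0 V) \<theta> * mass (1 / \<rho>) f"
proof -
  define t where "t = \<alpha> / n"
  have n: "0 < n" using \<alpha> by linarith
  have t: "0 < t" "t < 1" using \<alpha> n by (auto simp: t_def)
  have \<alpha>t: "\<alpha> = t * n" using n by (simp add: t_def)
  have \<rho>t: "t < p * \<rho>" "p * \<rho> < 1" "\<rho> + t < 1"
    using \<rho> pq n by (auto simp: \<alpha>t field_simps)
  have "0 < p * \<rho>" using \<rho>t(1) t by linarith
  then have \<rho>0: "0 < \<rho>" using pq by (simp add: zero_less_mult_iff)
  have q: "0 < q - 1 / p" using pq by (simp add: field_simps)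
  define r where "r = 1 / \<rho>"
  define a where "a = 1 / (\<rho> + t)"
  define s where "s = 1 / (p * \<rho> - t)"
  have r: "0 < r" and a: "1 < a" and s: "0 < s" and s0: "0 < s\<^sub>0"
    using \<rho>0 \<rho>t t pq \<alpha> n by (auto simp: r_def a_def s_def s\<^sub>0_def)
  \<comment> \<open>Hoelder exponents for the \<open>a\<close>-th powers, chosen so that the two
    factors become \<open>mass s\<^sub>0 V\<close> and \<open>mass s J\<close>.\<close>
  define P where "P = s\<^sub>0 / ((q - 1 / p) * a)"
  define Q where "Q = s * p / a"
  have PQ: "1 / P + 1 / Q = 1"
  proof -
    \<comment> \<open>The inner potential followed by the root lowers the reciprocal exponent by
      \<open>t / p\<close>, the outer potential by \<open>t\<close>. The factor in \<open>V\<close>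
      restores exactly this amount, so \<open>r\<close> returns to itself.\<close>
    have "(q - 1 / p) / s\<^sub>0 = t + t / p"
    proof -
      have "q - 1 / p = (p * q - 1) / p" using pq by (simp add: field_simps)
      then show ?thesis using pq \<alpha> n by (simp add: s\<^sub>0_def t_def) (simp add: field_simps)
    qed
    moreover have "1 / (s * p) = \<rho> - t / p"
      using pq by (simp add: s_def diff_divide_distrib)
    moreover have "1 / P + 1 / Q = a * ((q - 1 / p) / s\<^sub>0 + 1 / (s * p))"
      by (simp add: P_def Q_def distrib_left)
    ultimately show ?thesis using \<rho>0 t by (simp add: a_def)
  qed
  have "0 < P" "0 < Q" using a s s0 pq q by (auto simp: P_def Q_def)
  with PQ have PQ1: "1 < P" "1 < Q"
  proof -
    have "1 / P < 1" "1 / Q < 1" using PQ \<open>0 < P\<close> \<open>0 < Q\<close> by (smt (verit) divide_pos_pos)+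
    then show "1 < P" "1 < Q" using \<open>0 < P\<close> \<open>0 < Q\<close> by simp_all
  qed
  obtain C1 where C1: "0 < C1" "\<And>g :: 'a \<Rightarrow> ennreal. g \<in> borel_measurable borel \<Longrightarrow>
    mass r (riesz \<alpha> g) \<le> ennreal C1 * epow (mass a g) (r / a)"
  proof (rule Hardy_Littlewood_Sobolev[where 'a='a, of \<alpha> a r])
    show "\<alpha> * a < real DIM('a)"
      using n t \<rho>0 by (simp add: \<alpha>t a_def n_def[symmetric] divide_less_eq)
    show "1 / r = 1 / a - \<alpha> / real DIM('a)"
      by (simp add: r_def a_def t_def n_def)
  qed (use \<alpha> a in \<open>auto simp: n_def\<close>)
  obtain C2 where C2: "0 < C2" "\<And>g :: 'a \<Rightarrow> ennreal. g \<in> borel_measurable borel \<Longrightarrow>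
    mass s (riesz \<alpha> g) \<le> ennreal C2 * epow (mass (r / p) g) (s / (r / p))"
  proof (rule Hardy_Littlewood_Sobolev[where 'a='a, of \<alpha> "r / p" s])
    show "1 < r / p" using \<rho>t \<rho>0 pq by (simp add: r_def field_simps)
    show "\<alpha> * (r / p) < real DIM('a)"
      using n pq \<rho>0 \<rho>t by (simp add: \<alpha>t r_def n_def[symmetric] divide_less_eq mult.commute)
    show "1 / s = 1 / (r / p) - \<alpha> / real DIM('a)"
      by (simp add: r_def s_def t_def n_def)
  qed (use \<alpha> in \<open>auto simp: n_def\<close>)
  show ?thesis
  proof (rule that[of "C1 * (C2 powr (1 / Q)) powr (r / a)" "r / (a * P)"])
    show "0 < C1 * (C2 powr (1 / Q)) powr (r / a)" "0 < r / (a * P)"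
      using C1 C2 r a PQ1 by auto
  next
    fix V f :: "'a \<Rightarrow> ennreal"
    assume [measurable]: "V \<in> borel_measurable borel" "f \<in> borel_measurable borel"
    define J where "J = riesz \<alpha> (\<lambda>y. epow (f y) p)"
    have [measurable]: "J \<in> borel_measurable borel" unfolding J_def by measurable
    define h where "h = (\<lambda>x. epow (V x) (q - 1 / p) * epow (J x) (1 / p))"
    have [measurable]: "h \<in> borel_measurable borel" unfolding h_def by measurable
    have "mass s J \<le> ennreal C2 * epow (mass (r / p) (\<lambda>y. epow (f y) p)) (s / (r / p))"
      unfolding J_def by (rule C2) measurable
    then have J: "mass s J \<le> ennreal C2 * epow (mass r f) (s * p / r)"
      using pq by (simp add: mass_epow)
    have "mass a h = (\<integral>\<^sup>+x. epow (V x) ((q - 1 / p) * a) * epow (J x) (a / p) \<partial>lborel)"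
      by (simp add: mass_def h_def epow_mult epow_epow)
    also have "\<dots> \<le> epow (\<integral>\<^sup>+x. epow (epow (V x) ((q - 1 / p) * a)) P \<partial>lborel) (1 / P)
                     * epow (\<integral>\<^sup>+x. epow (epow (J x) (a / p)) Q \<partial>lborel) (1 / Q)"
      by (rule nn_integral_Holder) (use PQ PQ1 in auto)
    also have "\<dots> = epow (mass s\<^sub>0 V) (1 / P) * epow (mass s J) (1 / Q)"
      using q a pq by (simp add: epow_epow mass_def P_def Q_def)
    also have "\<dots> \<le> epow (mass s\<^sub>0 V) (1 / P) * epow (ennreal C2 * epow (mass r f) (s * p / r)) (1 / Q)"
      using J PQ1 by (intro mult_left_mono epow_mono) auto
    also have "\<dots> = epow (mass s\<^sub>0 V) (1 / P) * (ennreal (C2 powr (1 / Q)) * epow (mass r f) (a / r))"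
    proof -
      have "s * p / r * (1 / Q) = a / r" using s pq by (simp add: Q_def)
      then show ?thesis using C2 by (simp only: epow_mult epow_epow) simp
    qed
    finally have "epow (mass a h) (r / a)
      \<le> epow (epow (mass s\<^sub>0 V) (1 / P) * (ennreal (C2 powr (1 / Q)) * epow (mass r f) (a / r))) (r / a)"
      using r a by (intro epow_mono) auto
    also have "\<dots> = epow (mass s\<^sub>0 V) (r / (a * P)) * (ennreal ((C2 powr (1 / Q)) powr (r / a)) * mass r f)"
      using r a by (simp add: epow_mult epow_epow ac_simps)
    finally have "ennreal C1 * epow (mass a h) (r / a)
      \<le> ennreal C1 * (epow (mass s\<^sub>0 V) (r / (a * P)) * (ennreal ((C2 powr (1 / Q)) powr (r / a)) * mass r f))"
      by (rule mult_left_mono) simp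
    also have "\<dots> = ennreal (C1 * (C2 powr (1 / Q)) powr (r / a)) * epow (mass s\<^sub>0 V) (r / (a * P)) * mass r f"
      using C1 by (simp add: ennreal_mult ac_simps)
    finally have "mass r (riesz \<alpha> h)
      \<le> ennreal (C1 * (C2 powr (1 / Q)) powr (r / a)) * epow (mass s\<^sub>0 V) (r / (a * P)) * mass r f"
      using C1(2)[of h] by (rule order_trans[rotated]) measurable
    then show "mass (1 / \<rho>) (riesz \<alpha> (\<lambda>x. epow (V x) (q - 1 / p) * epow (riesz \<alpha> (\<lambda>y. epow (f y) p) x) (1 / p)))
       \<le> ennreal (C1 * (C2 powr (1 / Q)) powr (r / a)) * epow (mass s\<^sub>0 V) (r / (a * P)) * mass (1 / \<rho>) f"
      by (simp add: h_def J_def r_def)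
  qed
qed

section \<open>Smallness, quasi-additivity and truncation\<close>

lemma small_factor:
  assumes "0 < C" "0 < \<theta>" "0 < \<eta>"
  obtains \<epsilon> :: real where "0 < \<epsilon>" "\<And>m. m \<le> ennreal \<epsilon> \<Longrightarrow> ennreal C * epow m \<theta> \<le> ennreal \<eta>"
proof (rule that[of "(\<eta> / C) powr (1 / \<theta>)"])
  show "0 < (\<eta> / C) powr (1 / \<theta>)" using assms by simp
next
  fix m assume "m \<le> ennreal ((\<eta> / C) powr (1 / \<theta>))"
  then have "epow m \<theta> \<le> epow (ennreal ((\<eta> / C) powr (1 / \<theta>))) \<theta>"
    using assms by (intro epow_mono) auto
  also have "\<dots> = ennreal (\<eta> / C)" using assms by (simp add: powr_powr)
  finally have "ennreal C * epow m \<theta> \<le> ennreal C * ennreal (\<eta> / C)"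
    by (rule mult_left_mono) simp
  also have "\<dots> = ennreal \<eta>" using assms by (simp add: ennreal_mult[symmetric])
  finally show "ennreal C * epow m \<theta> \<le> ennreal \<eta>" .
qed

text \<open>The quasi-triangle inequality is applied twice. Exponent \<open>p\<close> inside costs
  \<open>2 powr p\<close>, which the outer root turns into 2, and exponent \<open>1 / p\<close>
  outside costs \<open>2 powr (1 / p)\<close>.\<close>

lemma lifting_operator_add_le:
  fixes f g :: "'a::euclidean_space \<Rightarrow> ennreal"
  assumes p: "0 < p" and [measurable]: "f \<in> borel_measurable borel" "g \<in> borel_measurable borel" "h \<in> borel_measurable borel"
  shows "riesz \<alpha> (\<lambda>x. h x * epow (riesz \<alpha> (\<lambda>y. epow (f y + g y) p) x) (1 / p)) x
    \<le> ennreal (2 * 2 powr (1 / p)) * riesz \<alpha> (\<lambda>x. h x * epow (riesz \<alpha> (\<lambda>y. epow (f y) p) x) (1 / p)) x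
     + ennreal (2 * 2 powr (1 / p)) * riesz \<alpha> (\<lambda>x. h x * epow (riesz \<alpha> (\<lambda>y. epow (g y) p) x) (1 / p)) x"
    (is "_ \<le> ?K * riesz \<alpha> ?f x + ?K * riesz \<alpha> ?g x")
proof -
  let ?J = "\<lambda>f. riesz \<alpha> (\<lambda>y. epow (f y) p)"
  have J: "epow (?J (\<lambda>y. f y + g y) z) (1 / p) \<le> ?K * (epow (?J f z) (1 / p) + epow (?J g z) (1 / p))" for z
  proof -
    have "?J (\<lambda>y. f y + g y) z \<le> riesz \<alpha> (\<lambda>y. ennreal (2 powr p) * (epow (f y) p + epow (g y) p)) z"
      by (intro riesz_mono epow_add_le p)
    also have "\<dots> = ennreal (2 powr p) * (?J f z + ?J g z)"
      by (simp add: riesz_cmult riesz_add)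
    finally have "epow (?J (\<lambda>y. f y + g y) z) (1 / p) \<le> epow (ennreal (2 powr p) * (?J f z + ?J g z)) (1 / p)"
      using p by (intro epow_mono) auto
    also have "\<dots> = ennreal 2 * epow (?J f z + ?J g z) (1 / p)"
      unfolding epow_mult using p by (subst epow_ennreal) (auto simp: powr_powr)
    also have "\<dots> \<le> ennreal 2 * (ennreal (2 powr (1 / p)) * (epow (?J f z) (1 / p) + epow (?J g z) (1 / p)))"
      using p by (intro mult_left_mono epow_add_le) auto
    also have "\<dots> = ?K * (epow (?J f z) (1 / p) + epow (?J g z) (1 / p))"
      by (subst ennreal_mult) (auto simp: mult.assoc)
    finally show ?thesis .
  qed
  have "riesz \<alpha> (\<lambda>x. h x * epow (?J (\<lambda>y. f y + g y) x) (1 / p)) x \<le> riesz \<alpha> (\<lambda>x. ?K * ?f x + ?K * ?g x) x"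
  proof (intro riesz_mono)
    fix z
    have "h z * epow (?J (\<lambda>y. f y + g y) z) (1 / p) \<le> h z * (?K * (epow (?J f z) (1 / p) + epow (?J g z) (1 / p)))"
      by (intro mult_left_mono J) simp
    then show "h z * epow (?J (\<lambda>y. f y + g y) z) (1 / p) \<le> ?K * ?f z + ?K * ?g z"
      by (simp add: distrib_left ac_simps)
  qed
  also have "\<dots> = ?K * riesz \<alpha> ?f x + ?K * riesz \<alpha> ?g x"
    by (subst riesz_add; (subst riesz_cmult)?; (subst riesz_cmult)?; simp)
  finally show ?thesis .
qed

text \<open>Dominated convergence with majorant \<open>epow (V x) s\<close>: since
  \<open>V x\<close> is finite, the truncation eventually removes every point.\<close>

lemma mass_truncation_small:
  fixes V :: "'a::euclidean_space \<Rightarrow> ennreal"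
  assumes [measurable]: "V \<in> borel_measurable borel" and fin: "\<And>x. V x < top"
    and V: "mass s V < top" and "0 < (\<epsilon> :: real)"
  obtains k :: nat where "mass s (\<lambda>x. V x * indicator {x. \<not> (V x \<le> of_nat k \<and> norm x \<le> real k)} x) \<le> ennreal \<epsilon>"
proof -
  let ?E = "\<lambda>k x. \<not> (V x \<le> of_nat k \<and> norm x \<le> real k)"
  have "(\<lambda>k. \<integral>\<^sup>+x. epow (V x * indicator {x. ?E k x} x) s \<partial>lborel) \<longlonglongrightarrow> (\<integral>\<^sup>+x. 0 \<partial>(lborel :: 'a measure))"
  proof (rule nn_integral_dominated_convergence)
    show "(\<integral>\<^sup>+x. epow (V x) s \<partial>lborel) < \<infinity>" using V by (simp add: mass_def)
    show "AE x in lborel. (\<lambda>k. epow (V x * indicator {x. ?E k x} x) s) \<longlonglongrightarrow> 0"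
    proof (intro AE_I2 tendsto_eventually)
      fix x
      obtain k1 where k1: "V x < of_nat k1"
        using fin[of x] ennreal_Ex_less_of_nat[of "V x"] by (auto simp: less_top)
      obtain k2 where k2: "norm x \<le> real k2" using real_arch_simple by blast
      show "\<forall>\<^sub>F k in sequentially. epow (V x * indicator {x. ?E k x} x) s = 0"
      proof (rule eventually_sequentiallyI[of "max k1 k2"])
        fix k assume k: "max k1 k2 \<le> k"
        then have "(of_nat k1 :: ennreal) \<le> of_nat k" "real k2 \<le> real k" by auto
        then have "V x \<le> of_nat k" "norm x \<le> real k"
          using k1 k2 by (auto intro: order_trans less_imp_le)
        then show "epow (V x * indicator {x. ?E k x} x) s = 0"
          by (simp add: indicator_def)
      qed
    qed
  qed (auto split: split_indicator)
  then have "\<forall>\<^sub>F k in sequentially. (\<integral>\<^sup>+x. epow (V x * indicator {x. ?E k x} x) s \<partial>lborel) < ennreal \<epsilon>"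
    using assms by (intro order_tendstoD(2)) auto
  then obtain k where "(\<integral>\<^sup>+x. epow (V x * indicator {x. ?E k x} x) s \<partial>lborel) < ennreal \<epsilon>"
    by (auto simp: eventually_sequentially)
  then show ?thesis by (intro that[of k]) (simp add: mass_def)
qed

text \<open>Moves the integrability of \<open>U\<close> from \<open>1 / \<rho>\<^sub>0\<close> to
  \<open>1 / \<rho>\<close> inside the window where the operator is bounded. Smallness for both
  exponents is measured by the same \<open>mass s W\<close>, so one truncation level makes both
  bounds contractive.\<close>

lemma solution_lifting:
  fixes U V :: "'a::euclidean_space \<Rightarrow> ennreal" and \<alpha> p q \<rho> \<rho>\<^sub>0 :: real
  defines "n \<equiv> real DIM('a)"
  assumes [measurable]: "U \<in> borel_measurable borel" "V \<in> borel_measurable borel"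
    and U: "\<And>x. U x = riesz \<alpha> (\<lambda>y. epow (V y) q) x" and V: "\<And>x. V x = riesz \<alpha> (\<lambda>y. epow (U y) p) x"
    and fin: "\<And>x. V x < top"
    and \<alpha>: "0 < \<alpha>" "\<alpha> < n" and pq: "0 < p" "1 < p * q"
    and \<rho>: "\<alpha> / (p * n) < \<rho>" "\<rho> < 1 / p" "\<rho> + \<alpha> / n < 1"
    and \<rho>0: "\<alpha> / (p * n) < \<rho>\<^sub>0" "\<rho>\<^sub>0 < 1 / p" "\<rho>\<^sub>0 + \<alpha> / n < 1"
    and U_fin: "mass (1 / \<rho>\<^sub>0) U < top"
    and V_fin: "mass (n * (p * q - 1) / (\<alpha> * (p + 1))) V < top"
  shows "mass (1 / \<rho>) U < top"
proof -
  define s where "s = n * (p * q - 1) / (\<alpha> * (p + 1))"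
  define K where "K = 2 * 2 powr (1 / p)"
  have K: "0 < K" by (simp add: K_def)
  have n: "0 < n" using \<alpha> by linarith
  have pos: "0 < \<rho>" "0 < \<rho>\<^sub>0"
    using \<rho>(1) \<rho>0(1) \<alpha> pq n by (smt (verit) divide_pos_pos mult_pos_pos)+
  have q: "0 < q" "0 < q - 1 / p" using pq by (auto simp: field_simps zero_less_mult_iff dest: less_trans[OF zero_less_one])
  let ?T = "\<lambda>V f :: 'a \<Rightarrow> ennreal. riesz \<alpha> (\<lambda>x. epow (V x) (q - 1 / p) * epow (riesz \<alpha> (\<lambda>y. epow (f y) p) x) (1 / p))"
  have small: "\<exists>\<epsilon>>0. \<forall>W f. W \<in> borel_measurable borel \<longrightarrow> f \<in> borel_measurable borel \<longrightarrow> mass s W \<le> ennreal \<epsilon>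
      \<longrightarrow> mass (1 / \<sigma>) (\<lambda>x. ennreal K * ?T W f x) \<le> ennreal \<eta> * mass (1 / \<sigma>) f"
    if \<sigma>: "\<alpha> / (p * n) < \<sigma>" "\<sigma> < 1 / p" "\<sigma> + \<alpha> / n < 1" and \<eta>: "0 < \<eta>" for \<sigma> \<eta> :: real
  proof -
    obtain C \<theta> where C: "0 < C" "0 < \<theta>" "\<And>W f :: 'a \<Rightarrow> ennreal. W \<in> borel_measurable borel \<Longrightarrow> f \<in> borel_measurable borel \<Longrightarrow>
      mass (1 / \<sigma>) (?T W f) \<le> ennreal C * epow (mass s W) \<theta> * mass (1 / \<sigma>) f"
      by (rule lifting_operator_bound[where 'a='a, OF \<alpha>[unfolded n_def] pq \<sigma>[unfolded n_def], folded n_def, folded s_def])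
        (rule that, assumption+)
    obtain \<epsilon> where \<epsilon>: "0 < \<epsilon>" "\<And>m. m \<le> ennreal \<epsilon> \<Longrightarrow> ennreal (K powr (1 / \<sigma>) * C) * epow m \<theta> \<le> ennreal \<eta>"
      using small_factor[of "K powr (1 / \<sigma>) * C" \<theta> \<eta>] C K \<eta> by auto
    have "mass (1 / \<sigma>) (\<lambda>x. ennreal K * ?T W f x) \<le> ennreal \<eta> * mass (1 / \<sigma>) f"
      if [measurable]: "W \<in> borel_measurable borel" "f \<in> borel_measurable borel" and m: "mass s W \<le> ennreal \<epsilon>" for W f
    proof -
      have "mass (1 / \<sigma>) (\<lambda>x. ennreal K * ?T W f x) = ennreal (K powr (1 / \<sigma>)) * mass (1 / \<sigma>) (?T W f)"
        using K by (subst mass_cmult) auto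
      also have "\<dots> \<le> ennreal (K powr (1 / \<sigma>)) * (ennreal C * epow (mass s W) \<theta> * mass (1 / \<sigma>) f)"
        by (rule mult_left_mono[OF C(3)[of W f]]) auto
      also have "\<dots> = (ennreal (K powr (1 / \<sigma>) * C) * epow (mass s W) \<theta>) * mass (1 / \<sigma>) f"
        using C by (simp add: ennreal_mult ac_simps)
      also have "\<dots> \<le> ennreal \<eta> * mass (1 / \<sigma>) f"
        by (intro mult_right_mono \<epsilon>(2) m) auto
      finally show ?thesis .
    qed
    with \<epsilon>(1) show ?thesis by blast
  qed
  obtain \<epsilon>1 where \<epsilon>1: "0 < \<epsilon>1" "\<And>W f. W \<in> borel_measurable borel \<Longrightarrow> f \<in> borel_measurable borel \<Longrightarrow> mass s W \<le> ennreal \<epsilon>1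
      \<Longrightarrow> mass (1 / \<rho>) (\<lambda>x. ennreal K * ?T W f x) \<le> ennreal (1 / (2 * 2 powr (1 / \<rho>))) * mass (1 / \<rho>) f"
    using small[OF \<rho>, of "1 / (2 * 2 powr (1 / \<rho>))"] by auto
  obtain \<epsilon>2 where \<epsilon>2: "0 < \<epsilon>2" "\<And>W f. W \<in> borel_measurable borel \<Longrightarrow> f \<in> borel_measurable borel \<Longrightarrow> mass s W \<le> ennreal \<epsilon>2
      \<Longrightarrow> mass (1 / \<rho>\<^sub>0) (\<lambda>x. ennreal K * ?T W f x) \<le> ennreal (1 / 2) * mass (1 / \<rho>\<^sub>0) f"
    using small[OF \<rho>0, of "1 / 2"] by auto
  obtain k :: nat where k: "mass s (\<lambda>x. V x * indicator {x. \<not> (V x \<le> of_nat k \<and> norm x \<le> real k)} x) \<le> ennreal (min \<epsilon>1 \<epsilon>2)"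
    using mass_truncation_small[of V s "min \<epsilon>1 \<epsilon>2"] fin V_fin \<epsilon>1(1) \<epsilon>2(1) by (auto simp: s_def)
  define E where "E = {x. V x \<le> of_nat k \<and> norm x \<le> real k}"
  have [measurable]: "E \<in> sets borel" unfolding E_def by measurable
  define W where "W = (\<lambda>x. V x * indicator (- E) x)"
  have [measurable]: "W \<in> borel_measurable borel" unfolding W_def by measurable
  have W_small: "mass s W \<le> ennreal (min \<epsilon>1 \<epsilon>2)"
    using k by (simp only: W_def E_def Collect_neg_eq[symmetric])
  have W: "mass s W \<le> ennreal \<epsilon>1" "mass s W \<le> ennreal \<epsilon>2"
    by (rule order_trans[OF W_small ennreal_leI], simp)+
  define F where "F = riesz \<alpha> (\<lambda>y. epow (V y) q * indicator E y)"
  have F_meas [measurable]: "F \<in> borel_measurable borel" unfolding F_def by measurable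
  \<comment> \<open>The density of \<open>F\<close> is at most \<open>real k powr q\<close> and is
    supported in a ball, so its mass is finite for the exponent that the potential requires.\<close>
  have F_fin: "mass (1 / \<rho>) F < top"
    unfolding F_def
  proof (rule mass_riesz_finite)
    let ?a = "1 / (\<rho> + \<alpha> / real DIM('a))"
    have a: "0 < ?a" using pos \<alpha> by (simp add: add_pos_pos)
    have "mass ?a (\<lambda>y. epow (V y) q * indicator E y) \<le> (\<integral>\<^sup>+y. ennreal (real k powr (q * ?a)) * indicator (cball 0 (real k)) y \<partial>(lborel :: 'a measure))"
      unfolding mass_def
    proof (intro nn_integral_mono)
      fix y
      show "epow (epow (V y) q * indicator E y) ?a \<le> ennreal (real k powr (q * ?a)) * indicator (cball 0 (real k)) y"
      proof (cases "y \<in> E")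
        case True
        then have "epow (V y) (q * ?a) \<le> epow (ennreal (real k)) (q * ?a)"
          using a q by (intro epow_mono) (auto simp: E_def ennreal_of_nat_eq_real_of_nat)
        then show ?thesis using True by (simp add: epow_epow E_def)
      qed simp
    qed
    also have "\<dots> = ennreal (real k powr (q * ?a)) * emeasure lborel (cball (0 :: 'a) (real k))"
      by (rule nn_integral_cmult_indicator) simp
    also have "\<dots> < top"
      using emeasure_lborel_cball_finite[of "0 :: 'a" "real k"] by (simp add: ennreal_mult_less_top)
    finally show "mass ?a (\<lambda>y. epow (V y) q * indicator E y) < top" .
  qed (use \<alpha> pos \<rho> in \<open>auto simp: n_def\<close>)
  \<comment> \<open>Only the power \<open>q - 1 / p\<close> of \<open>V\<close> is truncated. The
    remaining power \<open>1 / p\<close> is rewritten through \<open>U\<close> by the second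
    equation, which gives degree one in \<open>U\<close>. On \<open>E\<close> the second summand
    vanishes because \<open>epow 0 a = 0\<close>.\<close>
  have W_pow: "epow (V y) q = epow (V y) q * indicator E y + epow (W y) (q - 1 / p) * epow (V y) (1 / p)" for y
  proof -
    have "epow (V y) q = epow (V y) (q - 1 / p) * epow (V y) (1 / p)"
      by (subst epow_add_right[symmetric]) simp
    then show ?thesis by (auto simp: W_def split: split_indicator)
  qed
  have U_eq: "U x = F x + ?T W U x" for x
  proof -
    have "U x = riesz \<alpha> (\<lambda>y. epow (V y) q * indicator E y + epow (W y) (q - 1 / p) * epow (V y) (1 / p)) x"
      by (subst U, subst W_pow) simp
    also have "\<dots> = F x + riesz \<alpha> (\<lambda>y. epow (W y) (q - 1 / p) * epow (V y) (1 / p)) x"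
      unfolding F_def by (rule riesz_add) measurable
    finally show ?thesis unfolding V[symmetric] .
  qed
  show ?thesis
  proof (rule lifting_by_iteration[where F=F and T="?T W" and S="\<lambda>f x. ennreal K * ?T W f x" and ?r0.0="1 / \<rho>\<^sub>0"])
    show "?T W f x \<le> ?T W g x" if "\<And>y. f y \<le> g y" for f g x
      using that pq by (intro riesz_mono mult_left_mono epow_mono) auto
    then show "ennreal K * ?T W f x \<le> ennreal K * ?T W g x" if "\<And>y. f y \<le> g y" for f g x
      using that by (intro mult_left_mono) auto
    show "?T W (\<lambda>y. f y + g y) x \<le> ennreal K * ?T W f x + ennreal K * ?T W g x"
      if "f \<in> borel_measurable borel" "g \<in> borel_measurable borel" for f g x
      unfolding K_def using pq that by (intro lifting_operator_add_le) auto
    show "(\<lambda>x. ennreal K * ?T W f x) \<in> borel_measurable borel" if [measurable]: "f \<in> borel_measurable borel" for f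
      by measurable
    show "U x \<le> F x + ?T W U x" for x using U_eq[of x] by simp
  qed (use \<epsilon>1(2) \<epsilon>2(2) W pos F_fin U_fin in auto)
qed

section \<open>Solutions of the integral system\<close>

text \<open>The integrands agree even at \<open>y = x\<close>, where both are 0 by the conventions
  for \<open>powr\<close> and division. Passing to the completed measure leaves the integral
  unchanged.\<close>

lemma riesz_pot_eq_riesz:
  fixes g :: "'a::euclidean_space \<Rightarrow> real"
  assumes "\<And>y. 0 \<le> g y"
  shows "riesz_pot \<alpha> g x = riesz \<alpha> (\<lambda>y. ennreal (g y)) x"
  unfolding riesz_pot_def riesz_def nn_integral_completion
proof (intro nn_integral_cong)
  fix y
  have "norm (x - y) powr (\<alpha> - real DIM('a)) = 1 / norm (x - y) powr (real DIM('a) - \<alpha>)"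
    using powr_minus_divide[of "norm (x - y)" "real DIM('a) - \<alpha>"] by simp
  then show "ennreal (g y / norm (x - y) powr (real DIM('a) - \<alpha>))
    = ennreal (g y) * ennreal (norm (x - y) powr (\<alpha> - real DIM('a)))"
    using assms by (simp add: ennreal_mult[symmetric])
qed

text \<open>The integral identities make Lebesgue measurable solutions Borel measurable, because
  the potential only depends on the a.e. class of its density.\<close>
lemma borel_measurable_riesz_pot:
  fixes u v :: "'a::euclidean_space \<Rightarrow> real"
  assumes "v \<in> borel_measurable lebesgue" and pos: "\<And>x. 0 \<le> u x"
    and u: "\<And>x. ennreal (u x) = riesz_pot \<alpha> (\<lambda>y. v y powr q) x"
  shows "u \<in> borel_measurable borel"
proof -
  obtain v' :: "'a \<Rightarrow> real" where v'[measurable]: "v' \<in> borel_measurable lborel"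
    and ae: "AE x in lborel. v x = v' x"
    using completion_ex_borel_measurable_real[OF assms(1)] by blast
  have "ennreal (u x) = riesz \<alpha> (\<lambda>y. ennreal (v' y powr q)) x" for x
    unfolding u by (subst riesz_pot_eq_riesz)
      (use ae in \<open>auto simp: riesz_def intro!: nn_integral_cong_AE\<close>)
  then have "u = (\<lambda>x. enn2real (riesz \<alpha> (\<lambda>y. ennreal (v' y powr q)) x))"
    using pos by (metis enn2real_ennreal)
  moreover have "(\<lambda>x. enn2real (riesz \<alpha> (\<lambda>y. ennreal (v' y powr q)) x)) \<in> borel_measurable borel"
    using v' by measurable
  ultimately show ?thesis by simp
qed

lemma in_Lp_iff_mass:
  fixes u :: "'a::euclidean_space \<Rightarrow> real"
  assumes [measurable]: "u \<in> borel_measurable borel" and pos: "\<And>x. 0 \<le> u x"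
  shows "in_Lp r u \<longleftrightarrow> mass r (\<lambda>x. ennreal (u x)) < top"
proof -
  have [measurable]: "u \<in> borel_measurable lebesgue"
    by (simp add: measurable_completion)
  have "(\<integral>\<^sup>+x. ennreal (norm (\<bar>u x\<bar> powr r)) \<partial>lebesgue) = mass r (\<lambda>x. ennreal (u x))"
    using pos by (simp add: nn_integral_completion mass_def)
  then show ?thesis
    by (simp add: in_Lp_def integrable_iff_bounded)
qed

section \<open>Exponent arithmetic for the full ranges\<close>

theorem theorem2p1:
  fixes u v :: "'a::euclidean_space \<Rightarrow> real"
    and \<alpha> p q r s :: real
  defines "n \<equiv> real DIM('a)"
  assumes "DIM('a) \<ge> 3"
    and "0 < \<alpha>" and "\<alpha> < n"
    and "p > 0" and "q > 0" and "p * q > 1" and "p \<le> q"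
    and "1 / (p + 1) + 1 / (q + 1) \<le> (n - \<alpha>) / n"
    and "positive_solution \<alpha> p q u v"
    and "in_Lp (n * (p * q - 1) / (\<alpha> * (q + 1))) u"
    and "in_Lp (n * (p * q - 1) / (\<alpha> * (p + 1))) v"
    and "0 < 1 / r" and "1 / r < (n - \<alpha>) / n"
    and "0 < 1 / s" and "1 / s < min ((n - \<alpha>) / n) ((p * n - (p + 1) * \<alpha>) / n)"
  shows "in_Lp r u \<and> in_Lp s v"
proof -
  note \<alpha> = \<open>0 < \<alpha>\<close> \<open>\<alpha> < n\<close> and p = \<open>p > 0\<close> and q = \<open>q > 0\<close> and pq = \<open>p * q > 1\<close>
  have n: "0 < n" using \<alpha> by linarith
  define t where "t = \<alpha> / n"
  have t: "0 < t" "t < 1" and \<alpha>t: "\<alpha> = t * n" using \<alpha> n by (auto simp: t_def)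
  define S where "S = min (1 - t) (p * (1 - t) - t)"
  have nt: "(n - \<alpha>) / n = 1 - t"
    using n by (simp add: t_def diff_divide_distrib)
  have "p * n - (p + 1) * \<alpha> = (p * (1 - t) - t) * n"
    by (simp add: \<alpha>t algebra_simps)
  then have S_eq: "min ((n - \<alpha>) / n) ((p * n - (p + 1) * \<alpha>) / n) = S"
    using n by (simp add: S_def nt)
  define U where "U x = ennreal (u x)" for x
  define V where "V x = ennreal (v x)" for x
  have sol: "u \<in> borel_measurable lebesgue" "v \<in> borel_measurable lebesgue" "\<And>x. 0 < u x" "\<And>x. 0 < v x"
    "\<And>x. ennreal (u x) = riesz_pot \<alpha> (\<lambda>y. v y powr q) x"
    "\<And>x. ennreal (v x) = riesz_pot \<alpha> (\<lambda>y. u y powr p) x"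
    using \<open>positive_solution \<alpha> p q u v\<close> by (auto simp: positive_solution_def)
  have u_meas [measurable]: "u \<in> borel_measurable borel" and v_meas [measurable]: "v \<in> borel_measurable borel"
    using borel_measurable_riesz_pot[OF sol(2) less_imp_le[OF sol(3)] sol(5)]
          borel_measurable_riesz_pot[OF sol(1) less_imp_le[OF sol(4)] sol(6)] by auto
  have [measurable]: "U \<in> borel_measurable borel" "V \<in> borel_measurable borel"
    unfolding U_def[abs_def] V_def[abs_def] by measurable
  have U: "U x = riesz \<alpha> (\<lambda>y. epow (V y) q) x" and V: "V x = riesz \<alpha> (\<lambda>y. epow (U y) p) x" for x
    using sol(5)[of x] sol(6)[of x] sol(3,4) by (simp_all add: U_def V_def riesz_pot_eq_riesz less_imp_le)
  have riesz_V: "riesz \<alpha> (\<lambda>y. epow (V y) q) = U" and riesz_U: "riesz \<alpha> (\<lambda>y. epow (U y) p) = V"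
    by (rule ext, rule U[symmetric]) (rule ext, rule V[symmetric])
  have Lp_u: "in_Lp a u \<longleftrightarrow> mass a U < top" and Lp_v: "in_Lp a v \<longleftrightarrow> mass a V < top" for a
    using in_Lp_iff_mass[OF u_meas less_imp_le[OF sol(3)]] in_Lp_iff_mass[OF v_meas less_imp_le[OF sol(4)]]
    by (simp_all add: U_def[abs_def] V_def[abs_def])
  \<comment> \<open>Reciprocals of the two given exponents. The relations \<open>p\<rho>0\<close>
    and \<open>q\<sigma>0\<close> say that each equation maps one given exponent exactly to the
    other.\<close>
  define \<rho>0 where "\<rho>0 = t * (q + 1) / (p * q - 1)"
  define \<sigma>0 where "\<sigma>0 = t * (p + 1) / (p * q - 1)"
  have pos0: "0 < \<rho>0" "0 < \<sigma>0" using t p q pq by (auto simp: \<rho>0_def \<sigma>0_def)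
  have p\<rho>0: "p * \<rho>0 = \<sigma>0 + t" and q\<sigma>0: "q * \<sigma>0 = \<rho>0 + t"
    using pq by (simp_all add: \<rho>0_def \<sigma>0_def field_simps)
  have crit: "1 / (p + 1) + 1 / (q + 1) \<le> 1 - t"
    using assms(9) by (simp add: nt)
  \<comment> \<open>Cleared of denominators, the hypothesis on \<open>p\<close> and \<open>q\<close>
    becomes \<open>t * ((p + 1) * (q + 1)) \<le> p * q - 1\<close>, and both bounds are
    rearrangements of it.\<close>
  have \<rho>0_le: "\<rho>0 \<le> 1 / (p + 1)" and \<sigma>0_le: "\<sigma>0 \<le> 1 / (q + 1)"
  proof -
    have "(1 / (p + 1) + 1 / (q + 1) + t) * ((p + 1) * (q + 1)) \<le> 1 * ((p + 1) * (q + 1))"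
      using crit p q by (intro mult_right_mono) auto
    moreover have "1 / (p + 1) * ((p + 1) * (q + 1)) = q + 1" "1 / (q + 1) * ((p + 1) * (q + 1)) = p + 1"
      using p q by simp_all
    ultimately have "q + 1 + (p + 1) + t * ((p + 1) * (q + 1)) \<le> (p + 1) * (q + 1)"
      by (simp only: distrib_right[of _ _ "(p + 1) * (q + 1)"])
    then have "t * ((p + 1) * (q + 1)) \<le> p * q - 1"
      by (simp add: algebra_simps)
    then show "\<rho>0 \<le> 1 / (p + 1)" "\<sigma>0 \<le> 1 / (q + 1)"
      using p q pq by (simp_all add: \<rho>0_def \<sigma>0_def divide_le_eq le_divide_eq ac_simps)
  qed
  have inv_pos: "0 < 1 / (p + 1)" "0 < 1 / (q + 1)" using p q by auto
  have \<rho>0: "t < p * \<rho>0" "p * \<rho>0 < 1" "\<rho>0 + t < 1"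
  proof -
    show "t < p * \<rho>0" using p\<rho>0 pos0 by simp
    have "p * \<rho>0 \<le> p * (1 / (p + 1))" using \<rho>0_le p by (intro mult_left_mono) auto
    also have "\<dots> < 1" using p by simp
    finally show "p * \<rho>0 < 1" .
    show "\<rho>0 + t < 1" using \<rho>0_le crit inv_pos by linarith
  qed
  have \<sigma>0: "\<sigma>0 < S"
  proof -
    have "p * \<rho>0 < p * (1 - t)" using \<rho>0(3) p by (intro mult_strict_left_mono) auto
    moreover have "\<sigma>0 < 1 - t" using \<sigma>0_le crit inv_pos by linarith
    ultimately show ?thesis using p\<rho>0 by (simp add: S_def)
  qed
  have U0: "mass (1 / \<rho>0) U < top" and V0: "mass (n * (p * q - 1) / (\<alpha> * (p + 1))) V < top"
  proof -
    have "n * (p * q - 1) / (\<alpha> * (q + 1)) = 1 / \<rho>0"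
      using n by (simp add: \<rho>0_def \<alpha>t)
    then show "mass (1 / \<rho>0) U < top" using assms(11) by (simp add: Lp_u)
    show "mass (n * (p * q - 1) / (\<alpha> * (p + 1))) V < top" using assms(12) by (simp add: Lp_v)
  qed
  have range_iff: "\<alpha> / (p * n) < \<rho> \<longleftrightarrow> t < p * \<rho>" "\<rho> < 1 / p \<longleftrightarrow> p * \<rho> < 1" for \<rho>
    using n p by (auto simp: \<alpha>t field_simps)
  have lift: "mass (1 / \<rho>) U < top" if "t < p * \<rho>" "p * \<rho> < 1" "\<rho> + t < 1" for \<rho>
  proof (rule solution_lifting[where q=q and V=V and \<alpha>=\<alpha> and p=p and \<rho>\<^sub>0=\<rho>0])
    show "U x = riesz \<alpha> (\<lambda>y. epow (V y) q) x" for x by (rule U)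
    show "V x = riesz \<alpha> (\<lambda>y. epow (U y) p) x" for x by (rule V)
    show "V x < top" for x by (simp add: V_def)
  qed (use \<alpha> p pq that \<rho>0 U0 V0 in \<open>simp_all add: n_def[symmetric] range_iff t_def[symmetric]\<close>)
  \<comment> \<open>For \<open>\<rho> = (\<sigma> + t) / p\<close> the lifting window turns into
    \<open>0 < \<sigma>\<close>, \<open>\<sigma> < 1 - t\<close> and
    \<open>\<sigma> + t < p * (1 - t)\<close>, which is the range up to \<open>S\<close>.\<close>
  have V_fin: "mass (1 / \<sigma>) V < top" if \<sigma>: "0 < \<sigma>" "\<sigma> < S" for \<sigma>
  proof -
    have "mass (1 / ((\<sigma> + t) / p)) U < top"
    proof (rule lift)
      have "\<sigma> + t < (1 - t) * p" using \<sigma> by (simp add: S_def mult.commute)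
      then have "(\<sigma> + t) / p < 1 - t" using p by (simp add: pos_divide_less_eq)
      then show "(\<sigma> + t) / p + t < 1" by simp
    qed (use \<sigma> p in \<open>auto simp: S_def\<close>)
    then have "mass (1 / \<sigma>) (riesz \<alpha> (\<lambda>y. epow (U y) p)) < top"
      using \<alpha> \<sigma> by (intro mass_riesz_finite) (auto simp: n_def[symmetric] t_def[symmetric] mass_epow S_def)
    then show ?thesis by (simp only: riesz_U)
  qed
  \<comment> \<open>If \<open>(\<rho> + t) / q\<close> lies below \<open>S\<close>, one potential
    applied to \<open>epow (V y) q\<close> suffices. Otherwise \<open>\<sigma>0 < S\<close> forces
    \<open>\<rho>0 < \<rho>\<close>, and \<rho> lies in the lifting window itself.\<close>
  have U_fin: "mass (1 / \<rho>) U < top" if \<rho>: "0 < \<rho>" "\<rho> < 1 - t" for \<rho>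
  proof (cases "\<rho> + t < q * S")
    case True
    have "mass (1 / ((\<rho> + t) / q)) V < top"
      using True \<rho> t q by (intro V_fin) (auto simp: pos_divide_less_eq mult.commute)
    then have "mass (1 / \<rho>) (riesz \<alpha> (\<lambda>y. epow (V y) q)) < top"
      using \<alpha> \<rho> by (intro mass_riesz_finite) (auto simp: n_def[symmetric] t_def[symmetric] mass_epow)
    then show ?thesis by (simp only: riesz_V)
  next
    case False
    have "q * \<sigma>0 < q * S" using \<sigma>0 q by simp
    then have "\<rho>0 < \<rho>" using False q\<sigma>0 by linarith
    then have "p * \<rho>0 < p * \<rho>" using p by simp
    then have "t < p * \<rho>" using \<rho>0(1) by linarith
    \<comment> \<open>This is where \<open>p \<le> q\<close> enters: if
      \<open>1 \<le> p * \<rho>\<close>, then \<open>1 < p * (1 - t)\<close>, hence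
      \<open>S = 1 - t\<close> and \<open>1 < q * S\<close>, against
      \<open>q * S \<le> \<rho> + t < 1\<close>.\<close>
    moreover have "p * \<rho> < 1"
    proof (rule ccontr)
      assume "\<not> p * \<rho> < 1"
      moreover have "p * \<rho> < p * (1 - t)" using \<rho> p by simp
      ultimately have *: "1 < p * (1 - t)" by linarith
      then have S1: "S = 1 - t" by (simp add: S_def)
      have "p * (1 - t) \<le> q * (1 - t)" using \<open>p \<le> q\<close> t by (intro mult_right_mono) auto
      with * have "1 < q * S" unfolding S1 by linarith
      then show False using False \<rho> by linarith
    qed
    ultimately show ?thesis using \<rho> by (intro lift) auto
  qed
  have "mass (1 / (1 / r)) U < top" using assms(13,14) nt by (intro U_fin) auto
  moreover have "mass (1 / (1 / s)) V < top" using assms(15,16) unfolding S_eq by (intro V_fin)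
  ultimately show ?thesis by (simp add: Lp_u Lp_v)
qed

end
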